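(* Let $1<p<\infty$, $0<s<1$, $d\ge1$ and $m>s$. For a given affine hyperplane $H$ in $\mathbb R^d$, let $\Pi:\mathbb R^d\to\mathbb R^d$ be the reflection around $H$, where $H$ splits $\mathbb R^d$ into the two half-spaces $H_+$ and $H_-$. Then for every mild solution $u$ in $L^1$ of $\partial_tu+(-\Delta_p)^su^m=0$ in $\mathbb R^d\times(0,\infty)$ (i.e. mild solution of $\frac{du}{dt}+Au\ni0$ on $(0,\infty)$) with initial data $u(0)=u_0\in L^1(\mathbb R^d)$, if $$u_0(x)\le u_0(\Pi(x))\quad\text{for a.e. }x\in H_+,$$ then $$u(x,t)\le u(\Pi(x),t)\quad\text{for a.e. }x\in H_+\text{ and every }t>0.$$
   Context: Affine hyperplane: for $a_1,\dots,a_d,b\in\mathbb R$ with some $a_i\neq0$, $H=\{x: a_1x_1+\dots+a_dx_d=b\}$, with half-spaces $H_+=\{a_1x_1+\dots+a_dx_d>b\}$ and $H_-=\{a_1x_1+\dots+a_dx_d<b\}$. The reflection $\Pi$ around $H$ is the orthogonal reflection, i.e. the map which after a rotation and translation coincides with $(x',x_d)\mapsto(x',-x_d)$. Notation: $L^q=L^q(\mathbb R^d)$, $L^{1\cap\infty}=L^1\cap L^\infty$; for $r\in\mathbb R$, $a>0$, $r^a:=|r|^{a-1}r$ (so $u^m=|u|^{m-1}u$, $r^{p-1}=|r|^{p-2}r$). $[u]_{s,p}:=\big(\int_{\mathbb R^d}\int_{\mathbb R^d}\frac{|u(x)-u(y)|^p}{|x-y|^{d+sp}}\,dy\,dx\big)^{1/p}$;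 $W^{s,p}=W^{s,p}(\mathbb R^d)$ has norm $(\|u\|_p^p+[u]_{s,p}^p)^{1/p}$. Fractional $p$-Laplacian in $L^2$: for $u\in W^{s,p}\cap L^2$ and $v\in L^2$ one writes $v=(-\Delta_p)^su$ if $\int_{\mathbb R^d}v\xi\,dx=\frac12\int_{\mathbb R^{2d}}\frac{(u(x)-u(y))^{p-1}(\xi(x)-\xi(y))}{|x-y|^{d+sp}}\,d(x,y)$ for all $\xi\in W^{s,p}\cap L^2$. Its part in $L^{1\cap\infty}$ is $(-\Delta_p)^s_{1\cap\infty}:=\{(u,v)\in L^{1\cap\infty}\times L^{1\cap\infty}: v=(-\Delta_p)^su\}$. The operator $A$ in $L^1$: $(u,v)\in A$ iff $u,v\in L^1$ and there are $(u_k,v_k)$ with $v_k=(-\Delta_p)^s_{1\cap\infty}(u_k^m)$ for all $k$, $u_k\to u$ in $L^1$ and $v_k\to v$ in $L^1$. Mild solution in $L^1$ with initial datum $u_0\in L^1$: a function $u\in C([0,\infty);L^1)$ with $u(0)=u_0$ such that for every $T>0$ and $\varepsilon>0$ there are a partition $0=t_0<t_1<\dots<t_N=T$ with $\max_i(t_i-t_{i-1})<\varepsilon$ and $u_{0,\varepsilon}=u_0$, $u_{1,\varepsilon},\dots,u_{N,\varepsilon}\in D(A)$ with $u_{i,\varepsilon}+(t_i-t_{i-1})Au_{i,\varepsilon}\ni u_{i-1,\varepsilon}$ for $i\ge1$, such that the step functions $u_\varepsilon(t):=u_{i,\varepsilon}$ for $t\in[t_i,t_{i+1})$ converge to $u$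 uniformly in $t$ in the $L^1$-norm on $[0,T)$ as $\varepsilon\to0+$. *)

theory Defs
  imports "HOL-Analysis.Analysis"
begin

text \<open>
  Elements of the Lebesgue spaces over \<open>real ^ 'd\<close> are represented by Borel measurable functions
  (every class of almost everywhere equal functions has such a representative). Equality in
  a Lebesgue space is accordingly written as equality almost everywhere.
\<close>

definition hyperplane :: "real ^ 'd \<Rightarrow> real \<Rightarrow> (real ^ 'd) set" where
  "hyperplane a b = {x. a \<bullet> x = b}"

definition half_space_pos :: "real ^ 'd \<Rightarrow> real \<Rightarrow> (real ^ 'd) set" where
  "half_space_pos a b = {x. a \<bullet> x > b}"

definition hyperplane_reflection :: "real ^ 'd \<Rightarrow> real \<Rightarrow> real ^ 'd \<Rightarrow> real ^ 'd" where
  "hyperplane_reflection a b x = x - (2 * ((a \<bullet> x - b) / (a \<bullet> a))) *\<^sub>R a"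

text \<open>
  After a translation by \<open>- c\<close> and a rotation \<open>f\<close>, the hyperplane becomes a coordinate hyperplane
  and the reflection changes the sign of the corresponding coordinate \<open>k\<close> (which can be
  prescribed).
\<close>

lemma hyperplane_reflection_rigid_motion:
  fixes a :: "real ^ 'd" and k :: 'd
  assumes "a \<noteq> 0"
  shows "\<exists>f c. orthogonal_transformation f \<and> det (matrix f) = 1 \<and>
           (\<forall>x. x \<in> hyperplane a b \<longleftrightarrow> f (x - c) $ k = 0) \<and>
           (\<forall>x. f (hyperplane_reflection a b x - c) =
                 (\<chi> i. if i = k then - (f (x - c) $ i) else f (x - c) $ i))"
proof -
  have "\<exists>f r. orthogonal_transformation f \<and> det (matrix f) = 1 \<and> r \<noteq> 0 \<and> f a = r *\<^sub>R axis k 1"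
  proof (cases "2 \<le> CARD('d)")
    case True
    have "norm a = norm (norm a *\<^sub>R (axis k 1 :: real ^ 'd))" by simp
    from rotation_exists[OF True this] obtain f where
      "orthogonal_transformation f" "det (matrix f) = 1" "f a = norm a *\<^sub>R axis k 1" by blast
    moreover have "norm a \<noteq> 0" using assms by simp
    ultimately show ?thesis by blast
  next
    case False
    moreover have "CARD('d) > 0" by simp
    ultimately have "CARD('d) = 1" by linarith
    then obtain j :: 'd where j: "UNIV = {j}" by (auto simp: card_1_singleton_iff)
    then have all: "i = k" for i :: 'd
      by (metis UNIV_I singletonD)
    have ak: "a = (a $ k) *\<^sub>R axis k 1"
      by (simp add: vec_eq_iff axis_def) (metis all)
    then have "a $ k \<noteq> 0" using assms by (metis scale_zero_left)
    moreover have "orthogonal_transformation (id :: real ^ 'd \<Rightarrow> real ^ 'd)"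
      by (simp add: orthogonal_transformation_def id_def)
    moreover have "det (matrix (id :: real ^ 'd \<Rightarrow> real ^ 'd)) = 1"
      by (simp add: matrix_id_mat_1)
    ultimately show ?thesis using ak by (metis id_apply)
  qed
  then obtain f r where f: "orthogonal_transformation f" "det (matrix f) = 1"
    and r: "r \<noteq> 0" and fa: "f a = r *\<^sub>R axis k 1" by blast
  define c where "c = (b / (a \<bullet> a)) *\<^sub>R a"
  have aa: "a \<bullet> a \<noteq> 0" using assms by simp
  have lin: "linear f" using f(1) by (simp add: orthogonal_transformation_def)
  have inner: "f v \<bullet> f w = v \<bullet> w" for v w
    using f(1) by (simp add: orthogonal_transformation_def)
  have r2: "a \<bullet> a = r * r" using inner[of a a] by (simp add: fa inner_axis)
  have coord: "r * (f (x - c) $ k) = a \<bullet> x - b" for x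
  proof -
    have "r * (f (x - c) $ k) = f a \<bullet> f (x - c)"
      by (simp add: fa inner_commute[of "axis k 1"] inner_axis)
    also have "\<dots> = a \<bullet> x - b" using aa by (simp add: inner c_def inner_diff_right)
    finally show ?thesis .
  qed
  have 1: "x \<in> hyperplane a b \<longleftrightarrow> f (x - c) $ k = 0" for x
    using coord[of x] r by (auto simp: hyperplane_def)
  have 2: "f (hyperplane_reflection a b x - c) =
      (\<chi> i. if i = k then - (f (x - c) $ i) else f (x - c) $ i)" for x
  proof -
    define q where "q = 2 * ((a \<bullet> x - b) / (a \<bullet> a))"
    have qr: "q * r = 2 * (f (x - c) $ k)"
      unfolding q_def coord[of x, symmetric] r2 using r by simp
    have "f (hyperplane_reflection a b x - c) = f ((x - c) - q *\<^sub>R a)"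
      by (simp add: hyperplane_reflection_def q_def algebra_simps)
    also have "\<dots> = f (x - c) - (q * r) *\<^sub>R axis k 1"
      using lin by (simp add: linear_diff linear_cmul fa)
    finally show ?thesis by (simp add: qr vec_eq_iff axis_def)
  qed
  show ?thesis using f 1 2 by blast
qed

text \<open>The odd power \<open>\<bar>r\<bar>\<^bsup>a-1\<^esup> r\<close>; it vanishes at \<open>r = 0\<close>.\<close>

definition spow :: "real \<Rightarrow> real \<Rightarrow> real" where
  "spow r a = \<bar>r\<bar> powr (a - 1) * r"

definition Lq :: "real \<Rightarrow> (real ^ 'd \<Rightarrow> real) set" where
  "Lq q = {u \<in> borel_measurable lborel. integrable lborel (\<lambda>x. \<bar>u x\<bar> powr q)}"

definition L1 :: "(real ^ 'd \<Rightarrow> real) set" where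
  "L1 = {u. integrable lborel u}"

definition Linf :: "(real ^ 'd \<Rightarrow> real) set" where
  "Linf = {u \<in> borel_measurable lborel. \<exists>C. AE x in lborel. \<bar>u x\<bar> \<le> C}"

definition L1_dist :: "(real ^ 'd \<Rightarrow> real) \<Rightarrow> (real ^ 'd \<Rightarrow> real) \<Rightarrow> real" where
  "L1_dist u v = (\<integral>x. \<bar>u x - v x\<bar> \<partial>lborel)"

text \<open>The \<open>p\<close>-th power of the Gagliardo seminorm, with value in \<open>[0, \<infinity>]\<close>. The integrand is \<open>0\<close> on
  the diagonal, which is a null set.\<close>

definition gagliardo_pow :: "real \<Rightarrow> real \<Rightarrow> (real ^ 'd \<Rightarrow> real) \<Rightarrow> ennreal" where
  "gagliardo_pow s p u =
     (\<integral>\<^sup>+x. \<integral>\<^sup>+y. ennreal (\<bar>u x - u y\<bar> powr p / norm (x - y) powr (real CARD('d) + s * p))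
        \<partial>lborel \<partial>lborel)"

definition Wsp :: "real \<Rightarrow> real \<Rightarrow> (real ^ 'd \<Rightarrow> real) set" where
  "Wsp s p = {u \<in> Lq p. gagliardo_pow s p u < \<infinity>}"

text \<open>The relation \<open>v = (- \<Delta>\<^sub>p)\<^sup>s u\<close> in \<open>L\<^sup>2\<close>.\<close>

definition frac_p_Laplacian ::
    "real \<Rightarrow> real \<Rightarrow> (real ^ 'd \<Rightarrow> real) \<Rightarrow> (real ^ 'd \<Rightarrow> real) \<Rightarrow> bool" where
  "frac_p_Laplacian s p u v \<longleftrightarrow>
     u \<in> Wsp s p \<inter> Lq 2 \<and> v \<in> Lq 2 \<and>
     (\<forall>\<xi> \<in> Wsp s p \<inter> Lq 2.
        (\<integral>x. v x * \<xi> x \<partial>lborel) =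
        1 / 2 * (\<integral>(x, y). spow (u x - u y) (p - 1) * (\<xi> x - \<xi> y)
                           / norm (x - y) powr (real CARD('d) + s * p) \<partial>(lborel \<Otimes>\<^sub>M lborel)))"

definition frac_p_Laplacian_1inf ::
    "real \<Rightarrow> real \<Rightarrow> ((real ^ 'd \<Rightarrow> real) \<times> (real ^ 'd \<Rightarrow> real)) set" where
  "frac_p_Laplacian_1inf s p =
     {(u, v). u \<in> L1 \<inter> Linf \<and> v \<in> L1 \<inter> Linf \<and> frac_p_Laplacian s p u v}"

definition operator_A ::
    "real \<Rightarrow> real \<Rightarrow> real \<Rightarrow> ((real ^ 'd \<Rightarrow> real) \<times> (real ^ 'd \<Rightarrow> real)) set" where
  "operator_A s p m =
     {(u, v). u \<in> L1 \<and> v \<in> L1 \<and>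
        (\<exists>uk vk. (\<forall>k::nat. uk k \<in> L1 \<and> ((\<lambda>x. spow (uk k x) m), vk k) \<in> frac_p_Laplacian_1inf s p) \<and>
           (\<lambda>k. L1_dist (uk k) u) \<longlonglongrightarrow> 0 \<and> (\<lambda>k. L1_dist (vk k) v) \<longlonglongrightarrow> 0)}"

text \<open>A partition \<open>0 = \<tau> 0 < \<dots> < \<tau> N = T\<close> of mesh less than \<open>\<epsilon>\<close> together with a solution
  \<open>U 0, \<dots>, U N\<close> of the implicit Euler scheme \<open>U i + (\<tau> i - \<tau> (i - 1)) A (U i) \<ni> U (i - 1)\<close>.\<close>

definition euler_scheme ::
    "((real ^ 'd \<Rightarrow> real) \<times> (real ^ 'd \<Rightarrow> real)) set \<Rightarrow> (real ^ 'd \<Rightarrow> real) \<Rightarrow> real \<Rightarrow> real \<Rightarrow>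
     nat \<Rightarrow> (nat \<Rightarrow> real) \<Rightarrow> (nat \<Rightarrow> real ^ 'd \<Rightarrow> real) \<Rightarrow> bool" where
  "euler_scheme A u0 T \<epsilon> N \<tau> U \<longleftrightarrow>
     \<tau> 0 = 0 \<and> \<tau> N = T \<and>
     (\<forall>i<N. \<tau> i < \<tau> (Suc i) \<and> \<tau> (Suc i) - \<tau> i < \<epsilon>) \<and>
     U 0 \<in> L1 \<and> (AE x in lborel. U 0 x = u0 x) \<and>
     (\<forall>i<N. \<exists>v. (U (Suc i), v) \<in> A \<and>
        (AE x in lborel. U (Suc i) x + (\<tau> (Suc i) - \<tau> i) * v x = U i x))"

definition step_function ::
    "nat \<Rightarrow> (nat \<Rightarrow> real) \<Rightarrow> (nat \<Rightarrow> real ^ 'd \<Rightarrow> real) \<Rightarrow> real \<Rightarrow> real ^ 'd \<Rightarrow> real" where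
  "step_function N \<tau> U t = U (THE i. i < N \<and> t \<in> {\<tau> i..<\<tau> (Suc i)})"

definition continuous_L1 :: "(real \<Rightarrow> real ^ 'd \<Rightarrow> real) \<Rightarrow> bool" where
  "continuous_L1 u \<longleftrightarrow>
     (\<forall>t\<ge>0. u t \<in> L1) \<and>
     (\<forall>t\<ge>0. ((\<lambda>r. L1_dist (u r) (u t)) \<longlongrightarrow> 0) (at t within {0..}))"

text \<open>Only the values \<open>u t\<close> with \<open>t \<ge> 0\<close> are relevant. For each \<open>T\<close> a whole family of Euler schemes,
  indexed by \<open>\<epsilon> > 0\<close>, is required; the last condition is uniform convergence on \<open>[0, T)\<close>
  in the \<open>L\<^sup>1\<close>-norm as \<open>\<epsilon>\<close> decreases to \<open>0\<close>.\<close>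

definition mild_solution ::
    "((real ^ 'd \<Rightarrow> real) \<times> (real ^ 'd \<Rightarrow> real)) set \<Rightarrow> (real ^ 'd \<Rightarrow> real) \<Rightarrow>
     (real \<Rightarrow> real ^ 'd \<Rightarrow> real) \<Rightarrow> bool" where
  "mild_solution A u0 u \<longleftrightarrow>
     u0 \<in> L1 \<and> continuous_L1 u \<and> (AE x in lborel. u 0 x = u0 x) \<and>
     (\<forall>T>0. \<exists>N \<tau> U.
        (\<forall>\<epsilon>>0. euler_scheme A u0 T \<epsilon> (N \<epsilon>) (\<tau> \<epsilon>) (U \<epsilon>)) \<and>
        (\<forall>\<eta>>0. \<forall>\<^sub>F \<epsilon> in at_right 0. \<forall>t\<in>{0..<T}.
           L1_dist (step_function (N \<epsilon>) (\<tau> \<epsilon>) (U \<epsilon>) t) (u t) < \<eta>))"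

end

theory Submission
  imports Defs
begin

text \<open>
  Write \<open>R\<close> for the reflection, \<open>\<sigma>(x)\<close> for the sign of \<open>a \<bullet> x - b\<close>, and measure the failure of the
  ordering by the reflection defect \<open>D(f) = \<integral> max 0 (\<sigma>(x) (f(x) - f(R x))) dx\<close>. Its integrand is even
  under \<open>R\<close>, so \<open>D(f) = 0\<close> says exactly that \<open>f \<le> f \<circ> R\<close> almost everywhere on the positive side. The
  claim is that \<open>D\<close> does not increase along a mild solution. Since \<open>D\<close> is Lipschitz in \<open>L\<^sup>1\<close>
  (\<open>reflection_defect_lipschitz\<close>), it is enough that one step \<open>u + h v = f\<close> of the Euler scheme gives
  \<open>D(u) \<le> D(f)\<close>, and there it is enough to treat pairs with \<open>v = (- \<Delta>\<^sub>p)\<^sup>s w\<close>, \<open>w = u\<^sup>m\<close>, of which the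
  operator is the closure.

  For such a pair the equation is tested with \<open>\<xi> = \<sigma> \<phi>(\<sigma> (w - w \<circ> R))\<close>, where \<open>\<phi>\<close> is a bounded Lipschitz
  approximation of the indicator of the positive reals. Folding the double integral over the four points
  \<open>(x, y)\<close>, \<open>(R x, R y)\<close>, \<open>(x, R y)\<close>, \<open>(R x, y)\<close> leaves a sum with two kernels, one for points on the same
  side and one for points on opposite sides. The first kernel is the larger one, because two points
  of one side are closer to each other than one is to the mirror image of the other; together with
  the monotonicity of \<open>r \<mapsto> \<bar>r\<bar>\<^bsup>p-2\<^esup> r\<close> this makes the sum nonnegative (\<open>four_point_inequality\<close>).
  Hence \<open>\<integral> v \<xi> \<ge> 0\<close>. As \<open>\<phi>\<close> increases to the indicator, and since \<open>w\<close> and \<open>u\<close> have the same order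
  relations, this becomes \<open>\<integral> \<sigma> (v - v \<circ> R) \<ge> 0\<close> over the set where \<open>\<sigma> (u - u \<circ> R) > 0\<close>. That is the
  accretivity which yields \<open>D(u) \<le> D(u + h v)\<close> (\<open>reflection_defect_resolvent_le\<close>).

  The test function has to lie in \<open>W\<^sup>s\<^sup>,\<^sup>p\<close>, although \<open>\<xi>\<close> is not a Lipschitz function of
  \<open>w - w \<circ> R\<close>: it switches between a positive and a negative part across the hyperplane. The same
  comparison of kernels repairs this (\<open>reflection_test_difference_bound\<close>).
\<close>

section \<open>The reflection and Lebesgue measure\<close>

lemma hyperplane_reflection_involution:
  assumes "a \<noteq> 0"
  shows "hyperplane_reflection a b (hyperplane_reflection a b x) = x"
proof -
  have "a \<bullet> a \<noteq> 0" using assms by simp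
  then show ?thesis
    by (simp add: hyperplane_reflection_def inner_diff_right algebra_simps diff_divide_distrib
        flip: scaleR_add_left scaleR_diff_left)
qed

lemma inner_hyperplane_reflection:
  assumes "a \<noteq> 0"
  shows "a \<bullet> hyperplane_reflection a b x - b = - (a \<bullet> x - b)"
proof -
  have "a \<bullet> a \<noteq> 0" using assms by simp
  then show ?thesis
    by (simp add: hyperplane_reflection_def inner_diff_right)
qed

lemma dist_hyperplane_reflection:
  assumes "a \<noteq> 0"
  shows "(norm (x - hyperplane_reflection a b y))\<^sup>2
      = (norm (x - y))\<^sup>2 + 4 * ((a \<bullet> x - b) * (a \<bullet> y - b)) / (a \<bullet> a)"
proof -
  have aa: "a \<bullet> a \<noteq> 0" using assms by simp
  define c where "c = 2 * ((a \<bullet> y - b) / (a \<bullet> a))"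
  have c: "c * (a \<bullet> a) = 2 * (a \<bullet> y - b)" using aa by (simp add: c_def)
  have "(norm (x - hyperplane_reflection a b y))\<^sup>2 = (norm ((x - y) + c *\<^sub>R a))\<^sup>2"
    by (simp add: hyperplane_reflection_def c_def algebra_simps)
  also have "\<dots> = (norm (x - y))\<^sup>2 + 2 * c * (a \<bullet> (x - y)) + c * (c * (a \<bullet> a))"
    unfolding power2_norm_eq_inner
    by (simp add: inner_add_left inner_add_right inner_commute algebra_simps)
  also have "\<dots> = (norm (x - y))\<^sup>2 + 2 * c * (a \<bullet> x - b)"
    unfolding c by (simp add: inner_diff_right algebra_simps)
  also have "2 * c * (a \<bullet> x - b) = 4 * ((a \<bullet> x - b) * (a \<bullet> y - b)) / (a \<bullet> a)"
    by (simp add: c_def)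
  finally show ?thesis .
qed

lemma norm_reflection_swap:
  assumes "a \<noteq> 0"
  shows "norm (hyperplane_reflection a b x - y) = norm (x - hyperplane_reflection a b y)"
proof (rule power2_eq_imp_eq)
  show "(norm (hyperplane_reflection a b x - y))\<^sup>2 = (norm (x - hyperplane_reflection a b y))\<^sup>2"
    using dist_hyperplane_reflection[OF assms, of x b y] dist_hyperplane_reflection[OF assms, of y b x]
    by (simp add: norm_minus_commute mult.commute)
qed auto

lemma norm_reflection_reflection:
  assumes "a \<noteq> 0"
  shows "norm (hyperplane_reflection a b x - hyperplane_reflection a b y) = norm (x - y)"
  using norm_reflection_swap[OF assms, of b x "hyperplane_reflection a b y"]
  by (simp add: hyperplane_reflection_involution[OF assms])

text \<open>
  The geometric reason for the ordering: two points of one side interact more strongly with each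
  other than with the mirror images.
\<close>

lemma norm_le_norm_reflection:
  assumes "a \<noteq> 0" and "(a \<bullet> x - b) * (a \<bullet> y - b) \<ge> 0"
  shows "norm (x - y) \<le> norm (x - hyperplane_reflection a b y)"
proof (rule power2_le_imp_le)
  have "a \<bullet> a > 0" using assms by simp
  then show "(norm (x - y))\<^sup>2 \<le> (norm (x - hyperplane_reflection a b y))\<^sup>2"
    unfolding dist_hyperplane_reflection[OF assms(1)] using assms(2) by simp
qed auto

lemma hyperplane_reflection_borel [measurable]:
  "hyperplane_reflection a b \<in> borel_measurable borel"
  unfolding hyperplane_reflection_def[abs_def] by measurable

lemma nn_integral_lborel_shift:
  fixes h :: "'a::euclidean_space \<Rightarrow> ennreal"
  assumes [measurable]: "h \<in> borel_measurable borel"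
  shows "(\<integral>\<^sup>+x. h (c + x) \<partial>lborel) = (\<integral>\<^sup>+x. h x \<partial>lborel)"
proof -
  have "(\<integral>\<^sup>+x. h x \<partial>lborel) = (\<integral>\<^sup>+x. h x \<partial>distr lborel borel ((+) c))"
    by (simp add: lborel_distr_plus)
  also have "\<dots> = (\<integral>\<^sup>+x. h (c + x) \<partial>lborel)"
    by (subst nn_integral_distr) auto
  finally show ?thesis ..
qed

text \<open>
  An isometry preserves Lebesgue measure by uniqueness of Haar measure, and the unit ball \<open>B\<close> makes
  the argument a short computation: the product of its volume with the integral of \<open>h \<circ> f\<close> is turned
  by Fubini and translations into the product with the integral of \<open>h\<close>, since \<open>B\<close> is symmetric and
  invariant under \<open>f\<close>.
\<close>

lemma nn_integral_lborel_orthogonal: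
  fixes f :: "'a::euclidean_space \<Rightarrow> 'a" and h :: "'a \<Rightarrow> ennreal"
  assumes f: "orthogonal_transformation f" and [measurable]: "h \<in> borel_measurable borel"
  shows "(\<integral>\<^sup>+x. h (f x) \<partial>lborel) = (\<integral>\<^sup>+x. h x \<partial>lborel)"
proof -
  define g where "g = inv f"
  have fg: "f (g y) = y" for y
    using f by (simp add: g_def orthogonal_transformation_surj surj_f_inv_f)
  have g: "orthogonal_transformation g"
    using f by (simp add: g_def orthogonal_transformation_inv)
  have lin: "linear f" "linear g" using f g by (simp_all add: orthogonal_transformation_linear)
  have [measurable]: "f \<in> borel_measurable borel" "g \<in> borel_measurable borel"
    using lin by (auto intro!: borel_measurable_continuous_onI linear_continuous_on simp: linear_conv_bounded_linear)
  define B where "B = (indicator (ball 0 1) :: 'a \<Rightarrow> ennreal)"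
  have [measurable]: "B \<in> borel_measurable borel"
    unfolding B_def by (intro borel_measurable_indicator) simp
  have B_int: "(\<integral>\<^sup>+y. B y \<partial>lborel) = emeasure lborel (ball 0 1 :: 'a set)" by (simp add: B_def)
  have B_norm: "B y = B z" if "norm y = norm z" for y z
    using that by (simp add: B_def indicator_def)
  have "emeasure lborel (ball 0 1 :: 'a set) * (\<integral>\<^sup>+x. h (f x) \<partial>lborel)
      = (\<integral>\<^sup>+y. B y * (\<integral>\<^sup>+x. h (f x) \<partial>lborel) \<partial>lborel)"
    by (subst nn_integral_multc, measurable) (simp add: B_def)
  also have "\<dots> = (\<integral>\<^sup>+y. B y * (\<integral>\<^sup>+x. h (f (g y + x)) \<partial>lborel) \<partial>lborel)"
    by (subst nn_integral_lborel_shift[of "\<lambda>x. h (f x)"]) auto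
  also have "\<dots> = (\<integral>\<^sup>+y. (\<integral>\<^sup>+x. B y * h (f x + y) \<partial>lborel) \<partial>lborel)"
    by (simp add: nn_integral_cmult linear_add[OF lin(1)] fg add.commute)
  also have "\<dots> = (\<integral>\<^sup>+x. (\<integral>\<^sup>+y. B y * h (f x + y) \<partial>lborel) \<partial>lborel)"
    by (rule lborel_pair.Fubini') measurable
  also have "\<dots> = (\<integral>\<^sup>+x. (\<integral>\<^sup>+y. B (- f x + y) * h y \<partial>lborel) \<partial>lborel)"
    by (subst nn_integral_lborel_shift[of "\<lambda>y. B (- f x + y) * h y" "f x" for x, symmetric]) auto
  also have "\<dots> = (\<integral>\<^sup>+y. (\<integral>\<^sup>+x. B (- f x + y) * h y \<partial>lborel) \<partial>lborel)"
    by (rule lborel_pair.Fubini'[symmetric]) measurable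
  also have "\<dots> = (\<integral>\<^sup>+y. (\<integral>\<^sup>+x. B (- g y + x) * h y \<partial>lborel) \<partial>lborel)"
  proof -
    have "norm (- f x + y) = norm (- g y + x)" for x y
    proof -
      have "norm (- f x + y) = norm (f (- x + g y))"
        using lin by (simp add: linear_add linear_diff linear_neg fg)
      also have "\<dots> = norm (- g y + x)"
        using f by (simp add: orthogonal_transformation_norm norm_minus_commute)
      finally show ?thesis .
    qed
    then have "B (- f x + y) = B (- g y + x)" for x y by (rule B_norm)
    then show ?thesis by simp
  qed
  also have "\<dots> = (\<integral>\<^sup>+y. emeasure lborel (ball 0 1 :: 'a set) * h y \<partial>lborel)"
    by (simp add: nn_integral_multc nn_integral_lborel_shift[of B "- g y" for y, simplified] B_int)
  also have "\<dots> = emeasure lborel (ball 0 1 :: 'a set) * (\<integral>\<^sup>+y. h y \<partial>lborel)"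
    by (simp add: nn_integral_cmult)
  finally show ?thesis
    using unit_ball_vol_pos[of "real DIM('a)", THEN not_le[THEN iffD2]]
    by (simp del: unit_ball_vol_pos add: ennreal_mult_cancel_left emeasure_ball ennreal_eq_0_iff)
qed

lemma orthogonal_linear_part_hyperplane_reflection:
  assumes "a \<noteq> 0"
  shows "orthogonal_transformation (hyperplane_reflection a 0)"
proof -
  have "linear (hyperplane_reflection a 0)"
    unfolding hyperplane_reflection_def
    by (rule linearI) (simp_all add: inner_add_right algebra_simps add_divide_distrib)
  moreover have "norm (hyperplane_reflection a 0 v) = norm v" for v
    using norm_reflection_reflection[OF assms, of 0 v 0] by (simp add: hyperplane_reflection_def)
  ultimately show ?thesis by (simp add: orthogonal_transformation)
qed

lemma nn_integral_hyperplane_reflection: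
  fixes h :: "real ^ 'd \<Rightarrow> ennreal"
  assumes "a \<noteq> 0" and [measurable]: "h \<in> borel_measurable borel"
  shows "(\<integral>\<^sup>+x. h (hyperplane_reflection a b x) \<partial>lborel) = (\<integral>\<^sup>+x. h x \<partial>lborel)"
proof -
  define c where "c = (2 * (b / (a \<bullet> a))) *\<^sub>R a"
  have "hyperplane_reflection a b x = c + hyperplane_reflection a 0 x" for x
    by (simp add: hyperplane_reflection_def c_def diff_divide_distrib algebra_simps)
  then have "(\<integral>\<^sup>+x. h (hyperplane_reflection a b x) \<partial>lborel)
      = (\<integral>\<^sup>+x. h (c + hyperplane_reflection a 0 x) \<partial>lborel)" by simp
  also have "\<dots> = (\<integral>\<^sup>+x. h (c + x) \<partial>lborel)"
    by (rule nn_integral_lborel_orthogonal[OF orthogonal_linear_part_hyperplane_reflection[OF assms(1)]]) measurable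
  also have "\<dots> = (\<integral>\<^sup>+x. h x \<partial>lborel)" by (rule nn_integral_lborel_shift) simp
  finally show ?thesis .
qed

lemma distr_hyperplane_reflection:
  fixes a :: "real ^ 'd"
  assumes "a \<noteq> 0"
  shows "distr lborel lborel (hyperplane_reflection a b) = lborel"
proof (rule measure_eqI)
  fix A :: "(real ^ 'd) set" assume "A \<in> sets (distr lborel lborel (hyperplane_reflection a b))"
  then have [measurable]: "A \<in> sets borel" by simp
  have "emeasure (distr lborel lborel (hyperplane_reflection a b)) A
      = (\<integral>\<^sup>+x. indicator A x \<partial>distr lborel lborel (hyperplane_reflection a b))" by simp
  also have "\<dots> = (\<integral>\<^sup>+x. indicator A (hyperplane_reflection a b x) \<partial>lborel)"
    by (subst nn_integral_distr) auto
  also have "\<dots> = emeasure lborel A"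
    by (subst nn_integral_hyperplane_reflection[OF assms]) auto
  finally show "emeasure (distr lborel lborel (hyperplane_reflection a b)) A = emeasure lborel A" .
qed simp

lemma AE_hyperplane_reflection:
  fixes a :: "real ^ 'd"
  assumes "a \<noteq> 0" and "AE x in lborel. Q x"
  shows "AE x in lborel. Q (hyperplane_reflection a b x)"
  using AE_distrD[of "hyperplane_reflection a b" lborel lborel Q] assms(2)
  unfolding distr_hyperplane_reflection[OF assms(1)] by simp

lemma integrable_hyperplane_reflection:
  fixes h :: "real ^ 'd \<Rightarrow> real"
  assumes "a \<noteq> 0" and "integrable lborel h"
  shows "integrable lborel (\<lambda>x. h (hyperplane_reflection a b x))"
  using integrable_distr[of "hyperplane_reflection a b" lborel lborel h] assms
  by (simp add: distr_hyperplane_reflection)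

lemma integral_hyperplane_reflection:
  fixes h :: "real ^ 'd \<Rightarrow> real"
  assumes "a \<noteq> 0" and [measurable]: "h \<in> borel_measurable borel"
  shows "(\<integral>x. h (hyperplane_reflection a b x) \<partial>lborel) = (\<integral>x. h x \<partial>lborel)"
  using integral_distr[of "hyperplane_reflection a b" lborel lborel h] assms
  by (simp add: distr_hyperplane_reflection)

lemma distr_pair_lborel:
  fixes f g :: "'a::euclidean_space \<Rightarrow> 'a"
  assumes [measurable]: "f \<in> borel_measurable borel" "g \<in> borel_measurable borel"
    and "distr lborel lborel f = lborel" "distr lborel lborel g = lborel"
  shows "distr (lborel \<Otimes>\<^sub>M lborel) (lborel \<Otimes>\<^sub>M lborel) (\<lambda>(x, y). (f x, g y)) = lborel \<Otimes>\<^sub>M lborel"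
  using pair_measure_distr[of f lborel lborel g lborel lborel] assms
  by (simp add: sigma_finite_lborel)

lemma integral_pair_measure_preserving:
  fixes f g :: "'a::euclidean_space \<Rightarrow> 'a" and G :: "'a \<times> 'a \<Rightarrow> real"
  assumes [measurable]: "f \<in> borel_measurable borel" "g \<in> borel_measurable borel"
    and f: "distr lborel lborel f = lborel" and g: "distr lborel lborel g = lborel"
    and G: "integrable (lborel \<Otimes>\<^sub>M lborel) G"
  shows "integrable (lborel \<Otimes>\<^sub>M lborel) (\<lambda>(x, y). G (f x, g y))"
    and "(\<integral>(x, y). G (f x, g y) \<partial>(lborel \<Otimes>\<^sub>M lborel)) = (\<integral>z. G z \<partial>(lborel \<Otimes>\<^sub>M lborel))"
proof -
  note D = distr_pair_lborel[OF assms(1-4)]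
  have [measurable]: "G \<in> borel_measurable (lborel \<Otimes>\<^sub>M lborel)" using G by simp
  have M: "(\<lambda>(x, y). (f x, g y)) \<in> lborel \<Otimes>\<^sub>M lborel \<rightarrow>\<^sub>M lborel \<Otimes>\<^sub>M lborel"
    by measurable
  show "integrable (lborel \<Otimes>\<^sub>M lborel) (\<lambda>(x, y). G (f x, g y))"
    using integrable_distr[OF M, of G] G unfolding D by (simp add: case_prod_beta')
  show "(\<integral>(x, y). G (f x, g y) \<partial>(lborel \<Otimes>\<^sub>M lborel)) = (\<integral>z. G z \<partial>(lborel \<Otimes>\<^sub>M lborel))"
    using integral_distr[OF M, of G] unfolding D by (simp add: case_prod_beta')
qed

section \<open>The test function and the sign of its energy\<close>

lemma strict_mono_spow:
  assumes "0 < q"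
  shows "strict_mono (\<lambda>r. spow r q)"
proof (rule strict_monoI)
  have sp: "spow r q = sgn r * \<bar>r\<bar> powr q" for r
    by (cases "r = 0") (auto simp: spow_def powr_diff sgn_if abs_if)
  fix r t :: real assume "r < t"
  then consider "0 \<le> r" | "t \<le> 0" | "r < 0" "0 < t" by linarith
  then show "spow r q < spow t q"
  proof cases
    case 1
    then have "r powr q < t powr q" using \<open>r < t\<close> assms by (intro powr_less_mono2) auto
    then show ?thesis using 1 \<open>r < t\<close> unfolding sp by (cases "r = 0") auto
  next
    case 2
    then have "(- t) powr q < (- r) powr q" using \<open>r < t\<close> assms by (intro powr_less_mono2) auto
    then show ?thesis using 2 \<open>r < t\<close> unfolding sp by (cases "t = 0") auto
  next
    case 3
    then have "spow r q < 0" "0 < spow t q" unfolding sp by (auto simp: mult_neg_pos)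
    then show ?thesis by linarith
  qed
qed

lemma spow_borel [measurable]:
  assumes [measurable]: "f \<in> borel_measurable M"
  shows "(\<lambda>x. spow (f x) q) \<in> borel_measurable M"
  unfolding spow_def by measurable

text \<open>
  The properties of \<open>\<phi>\<close> that decide the sign of the energy. Both the Lipschitz approximations of the
  indicator of the positive reals and the positive part have them.
\<close>

definition cutoff :: "(real \<Rightarrow> real) \<Rightarrow> bool" where
  "cutoff \<phi> \<longleftrightarrow> mono \<phi> \<and> (\<forall>r\<le>0. \<phi> r = 0)"

definition reflection_test ::
    "real ^ 'd \<Rightarrow> real \<Rightarrow> (real \<Rightarrow> real) \<Rightarrow> (real ^ 'd \<Rightarrow> real) \<Rightarrow> real ^ 'd \<Rightarrow> real" where
  "reflection_test a b \<phi> w x =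
     sgn (a \<bullet> x - b) * \<phi> (sgn (a \<bullet> x - b) * (w x - w (hyperplane_reflection a b x)))"

lemma hyperplane_reflection_fixed: "a \<bullet> x = b \<Longrightarrow> hyperplane_reflection a b x = x"
  by (simp add: hyperplane_reflection_def)

lemma reflection_test_odd:
  assumes "a \<noteq> 0"
  shows "reflection_test a b \<phi> w (hyperplane_reflection a b x) = - reflection_test a b \<phi> w x"
proof -
  define \<sigma> where "\<sigma> = sgn (a \<bullet> x - b)"
  have "sgn (a \<bullet> hyperplane_reflection a b x - b) = - \<sigma>"
    unfolding inner_hyperplane_reflection[OF assms] \<sigma>_def by (rule sgn_minus)
  then show ?thesis
    unfolding reflection_test_def hyperplane_reflection_involution[OF assms] \<sigma>_def[symmetric]
    by (simp add: algebra_simps)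
qed

text \<open>
  On the hyperplane itself both sides vanish: the jump of \<open>w\<close> is \<open>0\<close> there, and \<open>\<phi> 0 = 0\<close>.
\<close>

lemma reflection_test_nonneg_side:
  assumes "cutoff \<phi>" and "a \<bullet> x \<ge> b"
  shows "reflection_test a b \<phi> w x = \<phi> (w x - w (hyperplane_reflection a b x))"
proof (cases "a \<bullet> x = b")
  case True
  then show ?thesis
    using assms(1) by (simp add: reflection_test_def hyperplane_reflection_fixed cutoff_def)
next
  case False
  then show ?thesis using assms by (simp add: reflection_test_def)
qed

text \<open>
  Here \<open>r, r'\<close> and \<open>t, t'\<close> stand for the values of \<open>w\<close> at \<open>x, R x\<close> and \<open>y, R y\<close>. The first product
  is nonnegative, so decreasing \<open>K1\<close> to \<open>K2\<close> only lowers the left-hand side. With equal kernels the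
  sum can be sorted by \<open>\<phi> (r - r')\<close> and \<open>\<phi> (t - t')\<close>; the first is positive only if \<open>r > r'\<close>, the
  second only if \<open>t > t'\<close>, and then monotonicity of \<open>F\<close> gives their factors the right sign.
  The alternative to \<open>K2 \<le> K1\<close> is for \<open>x = y\<close>, where the kernel \<open>1 / 0\<close> has the value \<open>0\<close>.
\<close>

lemma four_point_inequality:
  fixes F \<phi> :: "real \<Rightarrow> real"
  assumes F: "mono F" and \<phi>: "cutoff \<phi>" and K2: "0 \<le> K2"
    and K: "K2 \<le> K1 \<or> (r = t \<and> r' = t')"
  shows "0 \<le> K1 * ((F (r - t) - F (r' - t')) * (\<phi> (r - r') - \<phi> (t - t')))
    + K2 * ((F (r - t') - F (r' - t)) * (\<phi> (r - r') + \<phi> (t - t')))"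
    (is "0 \<le> K1 * ?X + K2 * ?Y")
proof -
  let ?\<alpha> = "\<phi> (r - r')" and ?\<beta> = "\<phi> (t - t')"
  have mF: "F y \<le> F z" if "y \<le> z" for y z using F that by (rule monoD)
  have m\<phi>: "\<phi> y \<le> \<phi> z" if "y \<le> z" for y z using \<phi> that by (auto simp: cutoff_def dest: monoD)
  have z: "\<phi> y = 0" if "y \<le> 0" for y using \<phi> that by (simp add: cutoff_def)
  have nn: "0 \<le> \<phi> y" for y using m\<phi>[of 0 y] z[of 0] z[of y] by (cases "y \<le> 0") auto
  have X: "0 \<le> ?X"
  proof (cases "t - t' \<le> r - r'")
    case True
    then show ?thesis
      using mF[of "r' - t'" "r - t"] m\<phi>[OF True] by (intro mult_nonneg_nonneg) auto
  next
    case False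
    then show ?thesis
      using mF[of "r - t" "r' - t'"] m\<phi>[of "r - r'" "t - t'"] by (intro mult_nonpos_nonpos) auto
  qed
  have "?X + ?Y = ?\<alpha> * ((F (r - t) - F (r' - t)) + (F (r - t') - F (r' - t')))
      + ?\<beta> * ((F (r' - t') - F (r' - t)) + (F (r - t') - F (r - t)))"
    by (simp add: algebra_simps)
  also have "\<dots> \<ge> 0"
  proof (rule add_nonneg_nonneg)
    show "0 \<le> ?\<alpha> * ((F (r - t) - F (r' - t)) + (F (r - t') - F (r' - t')))"
    proof (cases "r \<le> r'")
      case False
      then show ?thesis
        using mF[of "r' - t" "r - t"] mF[of "r' - t'" "r - t'"] nn by (intro mult_nonneg_nonneg) auto
    qed (simp add: z)
    show "0 \<le> ?\<beta> * ((F (r' - t') - F (r' - t)) + (F (r - t') - F (r - t)))"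
    proof (cases "t \<le> t'")
      case False
      then show ?thesis
        using mF[of "r' - t" "r' - t'"] mF[of "r - t" "r - t'"] nn by (intro mult_nonneg_nonneg) auto
    qed (simp add: z)
  qed
  finally have XY: "0 \<le> ?X + ?Y" .
  from K show ?thesis
  proof
    assume "K2 \<le> K1"
    then have "0 \<le> (K1 - K2) * ?X + K2 * (?X + ?Y)"
      by (intro add_nonneg_nonneg mult_nonneg_nonneg[OF _ X] mult_nonneg_nonneg[OF K2 XY]) simp
    then show ?thesis by (simp add: algebra_simps)
  next
    assume "r = t \<and> r' = t'"
    then have X0: "?X = 0" by simp
    with XY have "0 \<le> ?Y" by simp
    then have "0 \<le> K2 * ?Y" by (rule mult_nonneg_nonneg[OF K2])
    then show ?thesis unfolding X0 by simp
  qed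
qed

definition energy_density ::
    "(real \<Rightarrow> real) \<Rightarrow> real \<Rightarrow> (real ^ 'd \<Rightarrow> real) \<Rightarrow> (real ^ 'd \<Rightarrow> real) \<Rightarrow> (real ^ 'd) \<times> (real ^ 'd) \<Rightarrow> real"
  where
  "energy_density F \<kappa> w \<xi> = (\<lambda>(x, y). F (w x - w y) * (\<xi> x - \<xi> y) / norm (x - y) powr \<kappa>)"

lemma folded_energy_density_nonneg:
  fixes a :: "real ^ 'd" and b :: real and w :: "real ^ 'd \<Rightarrow> real"
  assumes a: "a \<noteq> 0" and F: "mono F" and \<phi>: "cutoff \<phi>" and \<kappa>: "0 \<le> \<kappa>"
  defines "R \<equiv> hyperplane_reflection a b"
  defines "G \<equiv> energy_density F \<kappa> w (reflection_test a b \<phi> w)"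
  shows "0 \<le> G (x, y) + G (R x, R y) + G (x, R y) + G (R x, y)"
proof -
  have RR: "R (R z) = z" for z by (simp add: R_def hyperplane_reflection_involution[OF a])
  have *: "0 \<le> G (x, y) + G (R x, R y) + G (x, R y) + G (R x, y)"
    if x: "a \<bullet> x \<ge> b" and y: "a \<bullet> y \<ge> b" for x y
  proof -
    define K1 where "K1 = 1 / norm (x - y) powr \<kappa>"
    define K2 where "K2 = 1 / norm (x - R y) powr \<kappa>"
    have n: "norm (R x - R y) = norm (x - y)" "norm (R x - y) = norm (x - R y)"
      unfolding R_def by (rule norm_reflection_reflection[OF a], rule norm_reflection_swap[OF a])
    have "K2 \<le> K1" if "x \<noteq> y"
    proof -
      have "norm (x - y) \<le> norm (x - R y)"
        using norm_le_norm_reflection[OF a, of x b y] x y by (simp add: R_def)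
      moreover have "0 < norm (x - y)" using that by simp
      ultimately show ?thesis
        unfolding K1_def K2_def using \<kappa> by (intro divide_left_mono powr_mono2 mult_pos_pos) auto
    qed
    then have K: "K2 \<le> K1 \<or> (w x = w y \<and> w (R x) = w (R y))" by auto
    have K2: "0 \<le> K2" by (simp add: K2_def)
    have \<xi>: "reflection_test a b \<phi> w x = \<phi> (w x - w (R x))"
      "reflection_test a b \<phi> w y = \<phi> (w y - w (R y))"
      using reflection_test_nonneg_side[OF \<phi>] x y by (auto simp: R_def)
    have \<xi>R: "reflection_test a b \<phi> w (R z) = - reflection_test a b \<phi> w z" for z
      by (simp add: R_def reflection_test_odd[OF a])
    have "G (x, y) + G (R x, R y) + G (x, R y) + G (R x, y)
      = K1 * ((F (w x - w y) - F (w (R x) - w (R y))) * (\<phi> (w x - w (R x)) - \<phi> (w y - w (R y))))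
      + K2 * ((F (w x - w (R y)) - F (w (R x) - w y)) * (\<phi> (w x - w (R x)) + \<phi> (w y - w (R y))))"
      by (simp add: G_def energy_density_def n \<xi>R \<xi> K1_def K2_def divide_inverse algebra_simps)
    then show ?thesis using four_point_inequality[OF F \<phi> K2 K] by simp
  qed
  have side: "a \<bullet> R z \<ge> b" if "\<not> a \<bullet> z \<ge> b" for z
    using inner_hyperplane_reflection[OF a, of b z] that by (simp add: R_def)
  show ?thesis
    using *[of x y] *[of "R x" y] *[of x "R y"] *[of "R x" "R y"] side[of x] side[of y]
    by (cases "a \<bullet> x \<ge> b"; cases "a \<bullet> y \<ge> b") (simp_all add: RR add.commute add.left_commute)
qed

text \<open>
  The four changes of variables preserve the product measure, so the average of the four
  densities has the same integral as one of them.
\<close>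

lemma integral_energy_density_nonneg:
  fixes a :: "real ^ 'd" and b :: real
  assumes a: "a \<noteq> 0" and F: "mono F" and \<phi>: "cutoff \<phi>" and \<kappa>: "0 \<le> \<kappa>"
  shows "0 \<le> (\<integral>z. energy_density F \<kappa> w (reflection_test a b \<phi> w) z \<partial>(lborel \<Otimes>\<^sub>M lborel))"
proof (cases "integrable (lborel \<Otimes>\<^sub>M lborel) (energy_density F \<kappa> w (reflection_test a b \<phi> w))")
  case True
  define R where "R = hyperplane_reflection a b"
  define G where "G = energy_density F \<kappa> w (reflection_test a b \<phi> w)"
  have G: "integrable (lborel \<Otimes>\<^sub>M lborel) G" using True by (simp add: G_def)
  have [measurable]: "R \<in> borel_measurable borel" by (simp add: R_def)
  have R: "distr lborel lborel R = lborel" by (simp add: R_def distr_hyperplane_reflection[OF a])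
  have id: "distr lborel lborel (\<lambda>x. x) = (lborel :: (real ^ 'd) measure)" by (rule distr_id)
  have I: "integrable (lborel \<Otimes>\<^sub>M lborel) (\<lambda>(x, y). G (f x, g y))"
    "(\<integral>(x, y). G (f x, g y) \<partial>(lborel \<Otimes>\<^sub>M lborel)) = (\<integral>z. G z \<partial>(lborel \<Otimes>\<^sub>M lborel))"
    if "f \<in> {R, (\<lambda>x. x)}" "g \<in> {R, (\<lambda>x. x)}" for f g
    using that R id by (auto intro!: integral_pair_measure_preserving[OF _ _ _ _ G])
  have "0 \<le> (\<integral>z. (case z of (x, y) \<Rightarrow> G (x, y)) + (case z of (x, y) \<Rightarrow> G (R x, R y))
      + (case z of (x, y) \<Rightarrow> G (x, R y)) + (case z of (x, y) \<Rightarrow> G (R x, y)) \<partial>(lborel \<Otimes>\<^sub>M lborel))"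
  proof (rule integral_nonneg_AE, rule AE_I2, clarify)
    fix x y
    show "0 \<le> G (x, y) + G (R x, R y) + G (x, R y) + G (R x, y)"
      unfolding G_def R_def by (rule folded_energy_density_nonneg[OF assms])
  qed
  also have "\<dots> = 4 * (\<integral>z. G z \<partial>(lborel \<Otimes>\<^sub>M lborel))"
    using I[of "\<lambda>x. x" "\<lambda>x. x"] I[of "\<lambda>x. x" R] I[of R "\<lambda>x. x"] I[of R R]
    by (subst Bochner_Integration.integral_add; (intro Bochner_Integration.integrable_add)?; simp)+
  finally show ?thesis by (simp add: G_def)
\<comment> \<open>A function that is not integrable has Bochner integral 0.\<close>
qed (simp add: not_integrable_integral_eq)

section \<open>Admissibility of the test function\<close>

lemma powr_sum_le:
  fixes A B C L q :: real
  assumes "0 \<le> q" "0 \<le> A" "0 \<le> B" "0 \<le> L" "0 \<le> C" "C \<le> L * (A + B)"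
  shows "C powr q \<le> (2 * L) powr q * (A powr q + B powr q)"
proof -
  have "L * (A + B) \<le> L * (2 * max A B)" using assms by (intro mult_left_mono) auto
  then have "C \<le> 2 * L * max A B" using assms by (simp add: mult.assoc mult.left_commute)
  then have "C powr q \<le> (2 * L * max A B) powr q" using assms by (intro powr_mono2) auto
  also have "\<dots> = (2 * L) powr q * max A B powr q" using assms by (simp add: powr_mult)
  also have "\<dots> \<le> (2 * L) powr q * (A powr q + B powr q)"
    by (intro mult_left_mono) (auto simp: max_def)
  finally show ?thesis .
qed

lemma reflection_test_borel:
  assumes "cutoff \<phi>" and [measurable]: "w \<in> borel_measurable borel"
  shows "reflection_test a b \<phi> w \<in> borel_measurable borel"
proof -
  have [measurable]: "\<phi> \<in> borel_measurable borel"
    using assms(1) by (intro borel_measurable_mono) (simp add: cutoff_def)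
  show ?thesis unfolding reflection_test_def[abs_def] by measurable
qed

lemma reflection_test_in_Lq:
  fixes a :: "real ^ 'd" and b :: real
  assumes a: "a \<noteq> 0" and \<phi>: "cutoff \<phi>" and L: "\<And>r t. \<bar>\<phi> r - \<phi> t\<bar> \<le> L * \<bar>r - t\<bar>"
    and q: "0 \<le> q" and w: "w \<in> Lq q"
  shows "reflection_test a b \<phi> w \<in> Lq q"
proof -
  define R where "R = hyperplane_reflection a b"
  have [measurable]: "w \<in> borel_measurable borel" "R \<in> borel_measurable borel"
    using w by (simp_all add: Lq_def R_def)
  have m [measurable]: "reflection_test a b \<phi> w \<in> borel_measurable borel"
    by (rule reflection_test_borel[OF \<phi>]) simp
  have L0: "0 \<le> L" using order_trans[OF abs_ge_zero L[of 1 0]] by simp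
  have i: "integrable lborel (\<lambda>x. \<bar>w x\<bar> powr q)" using w by (simp add: Lq_def)
  have iR: "integrable lborel (\<lambda>x. \<bar>w (R x)\<bar> powr q)"
    using integrable_hyperplane_reflection[OF a i, of b] by (simp add: R_def)
  have "\<bar>reflection_test a b \<phi> w x\<bar> powr q \<le> (2 * L) powr q * (\<bar>w x\<bar> powr q + \<bar>w (R x)\<bar> powr q)" for x
  proof (rule powr_sum_le)
    let ?g = "w x - w (R x)" and ?\<sigma> = "sgn (a \<bullet> x - b)"
    have "\<phi> 0 = 0" using \<phi> by (simp add: cutoff_def)
    have "\<bar>reflection_test a b \<phi> w x\<bar> \<le> \<bar>\<phi> (?\<sigma> * ?g) - \<phi> 0\<bar>"
      by (simp add: reflection_test_def R_def abs_mult \<open>\<phi> 0 = 0\<close> abs_sgn_eq)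
    also have "\<dots> \<le> L * \<bar>?\<sigma> * ?g\<bar>" using L[of "?\<sigma> * ?g" 0] by simp
    also have "\<dots> \<le> L * (\<bar>w x\<bar> + \<bar>w (R x)\<bar>)"
      using L0 by (intro mult_left_mono) (auto simp: abs_mult abs_sgn_eq)
    finally show "\<bar>reflection_test a b \<phi> w x\<bar> \<le> L * (\<bar>w x\<bar> + \<bar>w (R x)\<bar>)" .
  qed (use q L0 in auto)
  then have "integrable lborel (\<lambda>x. \<bar>reflection_test a b \<phi> w x\<bar> powr q)"
    by (intro Bochner_Integration.integrable_bound[OF
          integrable_mult_right[OF Bochner_Integration.integrable_add[OF i iR], of "(2 * L) powr q"]])
       (auto intro!: AE_I2)
  then show ?thesis using m by (simp add: Lq_def)
qed

text \<open>
  For two points on the same side the first bound holds because \<open>\<phi>\<close> is Lipschitz. For points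
  \<open>v\<close> and \<open>R v'\<close> on opposite sides the difference of the test function is \<open>\<phi> g + \<phi> h\<close> with the jumps
  \<open>g\<close>, \<open>h\<close> of \<open>w\<close> at \<open>v\<close>, \<open>v'\<close>. If both jumps are positive, then \<open>g + h\<close> is again a difference of
  \<open>w - w \<circ> R\<close> at the two points. If only one is positive, then the sum is at most
  \<open>\<bar>g - h\<bar>\<close>, a difference of \<open>w - w \<circ> R\<close> at \<open>v\<close> and \<open>v'\<close>. These points are distinct and not farther from each other than \<open>v\<close> from \<open>R v'\<close>, so
  the kernel there is at least as large.
\<close>

lemma reflection_test_difference_bound:
  fixes a :: "real ^ 'd" and b :: real and w :: "real ^ 'd \<Rightarrow> real"
  assumes a: "a \<noteq> 0" and \<phi>: "cutoff \<phi>" and L: "\<And>r t. \<bar>\<phi> r - \<phi> t\<bar> \<le> L * \<bar>r - t\<bar>"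
  defines "R \<equiv> hyperplane_reflection a b" and "\<xi> \<equiv> reflection_test a b \<phi> w"
  shows "\<bar>\<xi> x - \<xi> y\<bar> \<le> L * (\<bar>w x - w y\<bar> + \<bar>w (R x) - w (R y)\<bar>) \<or>
    x \<noteq> R y \<and> norm (x - R y) \<le> norm (x - y) \<and>
      \<bar>\<xi> x - \<xi> y\<bar> \<le> L * (\<bar>w x - w (R y)\<bar> + \<bar>w (R x) - w y\<bar>)"
    (is "?P x y \<or> ?Q x y")
proof -
  have L0: "0 \<le> L" using order_trans[OF abs_ge_zero L[of 1 0]] by simp
  have z: "\<phi> r = 0" if "r \<le> 0" for r using \<phi> that by (simp add: cutoff_def)
  have nn: "0 \<le> \<phi> r" for r
    using \<phi> z[of 0] z[of r] by (cases "r \<le> 0") (auto simp: cutoff_def dest: monoD[of \<phi> 0 r])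
  have lin: "\<phi> r \<le> L * r" if "0 \<le> r" for r using L[of r 0] z[of 0] that by simp
  have RR: "R (R v) = v" for v by (simp add: R_def hyperplane_reflection_involution[OF a])
  have \<xi>R: "\<xi> (R v) = - \<xi> v" for v by (simp add: \<xi>_def R_def reflection_test_odd[OF a])
  have \<xi>: "\<xi> v = \<phi> (w v - w (R v))" if "b \<le> a \<bullet> v" for v
    using reflection_test_nonneg_side[OF \<phi> that] by (simp add: \<xi>_def R_def)
  have same: "?P v v'" if "b \<le> a \<bullet> v" "b \<le> a \<bullet> v'" for v v'
  proof -
    have "\<bar>\<xi> v - \<xi> v'\<bar> \<le> L * \<bar>(w v - w (R v)) - (w v' - w (R v'))\<bar>"
      using L that by (simp add: \<xi>)
    also have "\<dots> \<le> L * (\<bar>w v - w v'\<bar> + \<bar>w (R v) - w (R v')\<bar>)"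
      using L0 by (intro mult_left_mono) auto
    finally show ?thesis .
  qed
  have opposite: "?P v (R v') \<or> ?Q v (R v')" if v: "b \<le> a \<bullet> v" and v': "b \<le> a \<bullet> v'" for v v'
  proof -
    let ?g = "w v - w (R v)" and ?h = "w v' - w (R v')"
    have d: "\<bar>\<xi> v - \<xi> (R v')\<bar> = \<phi> ?g + \<phi> ?h"
      using nn[of ?g] nn[of ?h] v v' by (simp add: \<xi>R \<xi>)
    show ?thesis
    proof (cases "(0 < ?g) = (0 < ?h)")
      case True
      have "\<phi> ?g + \<phi> ?h \<le> L * (\<bar>w v - w (R v')\<bar> + \<bar>w (R v) - w v'\<bar>)"
      proof (cases "0 < ?g")
        case True
        then have "\<phi> ?g + \<phi> ?h \<le> L * (?g + ?h)"
          using lin[of ?g] lin[of ?h] \<open>(0 < ?g) = (0 < ?h)\<close> by (simp add: distrib_left)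
        also have "\<dots> \<le> L * (\<bar>w v - w (R v')\<bar> + \<bar>w (R v) - w v'\<bar>)"
          using L0 by (intro mult_left_mono) auto
        finally show ?thesis .
      next
        case False
        then show ?thesis using z[of ?g] z[of ?h] \<open>(0 < ?g) = (0 < ?h)\<close> L0 by simp
      qed
      then have "?P v (R v')" using d by (simp add: RR)
      then show ?thesis ..
    next
      case False
      then have "v \<noteq> v'" by auto
      have "norm (v - v') \<le> norm (v - R v')"
        using norm_le_norm_reflection[OF a, of v b v'] v v' by (simp add: R_def)
      moreover have "\<phi> ?g + \<phi> ?h \<le> L * \<bar>?g - ?h\<bar>"
        using False lin[of ?g] lin[of ?h] z[of ?g] z[of ?h] L0
          mult_left_mono[of ?g "?g - ?h" L] mult_left_mono[of ?h "?h - ?g" L]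
        by (cases "0 < ?g") (auto simp: not_less)
      moreover have "L * \<bar>?g - ?h\<bar> \<le> L * (\<bar>w v - w v'\<bar> + \<bar>w (R v) - w (R v')\<bar>)"
        using L0 by (intro mult_left_mono) auto
      ultimately have "?Q v (R v')" using d \<open>v \<noteq> v'\<close> by (simp add: RR)
      then show ?thesis ..
    qed
  qed
  have side: "b \<le> a \<bullet> R v" if "\<not> b \<le> a \<bullet> v" for v
    using inner_hyperplane_reflection[OF a, of b v] that by (simp add: R_def)
  have neg: "\<bar>- r + t\<bar> = \<bar>r - t\<bar>" "\<bar>- r - t\<bar> = \<bar>r + t\<bar>" for r t :: real by simp_all
  have n: "norm (R v - R v') = norm (v - v')" "norm (R v - v') = norm (v - R v')" for v v'
    unfolding R_def by (rule norm_reflection_reflection[OF a], rule norm_reflection_swap[OF a])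
  have eqR: "R v = v' \<longleftrightarrow> v = R v'" for v v' using RR by metis
  show ?thesis
    using same[of x y] opposite[of x "R y"] opposite[of "R x" y] same[of "R x" "R y"] side[of x] side[of y]
    by (cases "b \<le> a \<bullet> x"; cases "b \<le> a \<bullet> y")
      (simp_all add: RR \<xi>R n neg eqR add.commute abs_minus_commute[of "\<xi> y" "\<xi> x"])
qed

definition gagliardo_density ::
    "real \<Rightarrow> real \<Rightarrow> (real ^ 'd \<Rightarrow> real) \<Rightarrow> real ^ 'd \<Rightarrow> real ^ 'd \<Rightarrow> real" where
  "gagliardo_density p \<kappa> u x y = \<bar>u x - u y\<bar> powr p / norm (x - y) powr \<kappa>"

lemma gagliardo_density_reflection_test:
  fixes a :: "real ^ 'd" and b :: real
  assumes a: "a \<noteq> 0" and \<phi>: "cutoff \<phi>" and L: "\<And>r t. \<bar>\<phi> r - \<phi> t\<bar> \<le> L * \<bar>r - t\<bar>"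
    and p: "0 \<le> p" and \<kappa>: "0 \<le> \<kappa>"
  defines "R \<equiv> hyperplane_reflection a b"
  shows "gagliardo_density p \<kappa> (reflection_test a b \<phi> w) x y \<le> (2 * L) powr p *
    (gagliardo_density p \<kappa> w x y + gagliardo_density p \<kappa> w (R x) (R y)
     + (gagliardo_density p \<kappa> w x (R y) + gagliardo_density p \<kappa> w (R x) y))"
    (is "_ \<le> ?C * (?q1 + ?q2 + (?q3 + ?q4))")
proof -
  let ?\<xi> = "reflection_test a b \<phi> w"
  have L0: "0 \<le> L" using order_trans[OF abs_ge_zero L[of 1 0]] by simp
  have n: "norm (R x - R y) = norm (x - y)" "norm (R x - y) = norm (x - R y)"
    unfolding R_def by (rule norm_reflection_reflection[OF a], rule norm_reflection_swap[OF a])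
  have q: "0 \<le> gagliardo_density p \<kappa> w v v'" for v v' by (simp add: gagliardo_density_def)
  from reflection_test_difference_bound[OF a \<phi> L, of b w x y]
  show ?thesis
    unfolding R_def[symmetric]
  proof
    assume "\<bar>?\<xi> x - ?\<xi> y\<bar> \<le> L * (\<bar>w x - w y\<bar> + \<bar>w (R x) - w (R y)\<bar>)"
    then have "\<bar>?\<xi> x - ?\<xi> y\<bar> powr p \<le> ?C * (\<bar>w x - w y\<bar> powr p + \<bar>w (R x) - w (R y)\<bar> powr p)"
      using p L0 by (intro powr_sum_le) auto
    then have "gagliardo_density p \<kappa> ?\<xi> x y
        \<le> ?C * (\<bar>w x - w y\<bar> powr p + \<bar>w (R x) - w (R y)\<bar> powr p) / norm (x - y) powr \<kappa>"
      unfolding gagliardo_density_def by (intro divide_right_mono) auto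
    also have "\<dots> = ?C * (?q1 + ?q2)" by (simp add: gagliardo_density_def n add_divide_distrib distrib_left)
    also have "\<dots> \<le> ?C * (?q1 + ?q2 + (?q3 + ?q4))"
      using q[of x "R y"] q[of "R x" y] by (intro mult_left_mono) auto
    finally show ?thesis .
  next
    assume *: "x \<noteq> R y \<and> norm (x - R y) \<le> norm (x - y) \<and>
      \<bar>?\<xi> x - ?\<xi> y\<bar> \<le> L * (\<bar>w x - w (R y)\<bar> + \<bar>w (R x) - w y\<bar>)"
    then have "\<bar>?\<xi> x - ?\<xi> y\<bar> powr p \<le> ?C * (\<bar>w x - w (R y)\<bar> powr p + \<bar>w (R x) - w y\<bar> powr p)"
      using p L0 by (intro powr_sum_le) auto
    moreover have "norm (x - R y) powr \<kappa> \<le> norm (x - y) powr \<kappa>" "0 < norm (x - R y) powr \<kappa>"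
      using * \<kappa> by (auto intro!: powr_mono2)
    ultimately have "gagliardo_density p \<kappa> ?\<xi> x y
        \<le> ?C * (\<bar>w x - w (R y)\<bar> powr p + \<bar>w (R x) - w y\<bar> powr p) / norm (x - R y) powr \<kappa>"
      unfolding gagliardo_density_def by (intro frac_le) auto
    also have "\<dots> = ?C * (?q3 + ?q4)" by (simp add: gagliardo_density_def n add_divide_distrib distrib_left)
    also have "\<dots> \<le> ?C * (?q1 + ?q2 + (?q3 + ?q4))"
      using q[of x y] q[of "R x" "R y"] by (intro mult_left_mono) auto
    finally show ?thesis .
  qed
qed

lemma nn_integral_reflect_arguments:
  fixes a :: "real ^ 'd" and Q :: "real ^ 'd \<Rightarrow> real ^ 'd \<Rightarrow> ennreal"
  assumes a: "a \<noteq> 0" and [measurable]: "(\<lambda>(x, y). Q x y) \<in> borel_measurable (borel \<Otimes>\<^sub>M borel)"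
    and f: "f = hyperplane_reflection a b \<or> f = (\<lambda>x. x)"
    and g: "g = hyperplane_reflection a b \<or> g = (\<lambda>x. x)"
  shows "(\<integral>\<^sup>+x. \<integral>\<^sup>+y. Q (f x) (g y) \<partial>lborel \<partial>lborel) = (\<integral>\<^sup>+x. \<integral>\<^sup>+y. Q x y \<partial>lborel \<partial>lborel)"
proof -
  have f1: "(\<integral>\<^sup>+x. h (f x) \<partial>lborel) = (\<integral>\<^sup>+x. h x \<partial>lborel)"
    and g1: "(\<integral>\<^sup>+x. h (g x) \<partial>lborel) = (\<integral>\<^sup>+x. h x \<partial>lborel)"
    if "h \<in> borel_measurable borel" for h
    using f g nn_integral_hyperplane_reflection[OF a that] by auto
  have "(\<integral>\<^sup>+y. Q (f x) (g y) \<partial>lborel) = (\<integral>\<^sup>+y. Q (f x) y \<partial>lborel)" for x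
    by (rule g1) measurable
  moreover have "(\<integral>\<^sup>+x. \<integral>\<^sup>+y. Q (f x) y \<partial>lborel \<partial>lborel) = (\<integral>\<^sup>+x. \<integral>\<^sup>+y. Q x y \<partial>lborel \<partial>lborel)"
    by (rule f1) measurable
  ultimately show ?thesis by simp
qed

text \<open>
  Each of the four reflected copies of the density of \<open>w\<close> in the pointwise bound integrates to the
  \<open>p\<close>-th power of the seminorm of \<open>w\<close>.
\<close>

lemma reflection_test_in_Wsp:
  fixes a :: "real ^ 'd" and b :: real
  assumes a: "a \<noteq> 0" and \<phi>: "cutoff \<phi>" and L: "\<And>r t. \<bar>\<phi> r - \<phi> t\<bar> \<le> L * \<bar>r - t\<bar>"
    and p: "0 \<le> p" and s: "0 \<le> s" and w: "w \<in> Wsp s p"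
  shows "reflection_test a b \<phi> w \<in> Wsp s p"
proof -
  define R where "R = hyperplane_reflection a b"
  define \<kappa> where "\<kappa> = real CARD('d) + s * p"
  have \<kappa>: "0 \<le> \<kappa>" using p s by (simp add: \<kappa>_def)
  have wp: "w \<in> Lq p" and fin: "gagliardo_pow s p w < \<infinity>" using w by (auto simp: Wsp_def)
  have [measurable]: "w \<in> borel_measurable borel" "R \<in> borel_measurable borel"
    using wp by (simp_all add: Lq_def R_def)
  define q where "q x y = ennreal (gagliardo_density p \<kappa> w x y)" for x y
  have q [measurable]: "(\<lambda>(x, y). q x y) \<in> borel_measurable (borel \<Otimes>\<^sub>M borel)"
    unfolding q_def gagliardo_density_def by measurable
  have nn: "0 \<le> gagliardo_density p \<kappa> w x y" for x y by (simp add: gagliardo_density_def)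
  let ?C = "(2 * L) powr p"
  let ?I = "\<integral>\<^sup>+x. \<integral>\<^sup>+y. q x y \<partial>lborel \<partial>lborel"
  have eq: "gagliardo_pow s p w = ?I"
    by (simp add: gagliardo_pow_def q_def gagliardo_density_def \<kappa>_def)
  have "gagliardo_pow s p (reflection_test a b \<phi> w)
      = (\<integral>\<^sup>+x. \<integral>\<^sup>+y. ennreal (gagliardo_density p \<kappa> (reflection_test a b \<phi> w) x y) \<partial>lborel \<partial>lborel)"
    by (simp add: gagliardo_pow_def gagliardo_density_def \<kappa>_def)
  also have "\<dots> \<le> (\<integral>\<^sup>+x. \<integral>\<^sup>+y. ennreal ?C * (q x y + q (R x) (R y) + (q x (R y) + q (R x) y)) \<partial>lborel \<partial>lborel)"
  proof (intro nn_integral_mono)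
    fix x y
    show "ennreal (gagliardo_density p \<kappa> (reflection_test a b \<phi> w) x y)
        \<le> ennreal ?C * (q x y + q (R x) (R y) + (q x (R y) + q (R x) y))"
      using gagliardo_density_reflection_test[OF a \<phi> L p \<kappa>, of b w x y] nn
      by (simp add: q_def R_def[symmetric] ennreal_leI flip: ennreal_plus ennreal_mult)
  qed
  also have "\<dots> = ennreal ?C * (?I + (\<integral>\<^sup>+x. \<integral>\<^sup>+y. q (R x) (R y) \<partial>lborel \<partial>lborel)
      + ((\<integral>\<^sup>+x. \<integral>\<^sup>+y. q x (R y) \<partial>lborel \<partial>lborel) + (\<integral>\<^sup>+x. \<integral>\<^sup>+y. q (R x) y \<partial>lborel \<partial>lborel)))"
    by (simp add: nn_integral_add nn_integral_cmult)
  also have "\<dots> = ennreal ?C * (?I + ?I + (?I + ?I))"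
    using nn_integral_reflect_arguments[OF a q, of R b R] nn_integral_reflect_arguments[OF a q, of R b "\<lambda>x. x"]
      nn_integral_reflect_arguments[OF a q, of "\<lambda>x. x" b R]
    by (simp add: R_def)
  also have "\<dots> < \<infinity>"
    using fin unfolding eq by (simp add: ennreal_mult_less_top)
  finally have "gagliardo_pow s p (reflection_test a b \<phi> w) < \<infinity>" .
  then show ?thesis using reflection_test_in_Lq[OF a \<phi> L p wp] by (simp add: Wsp_def)
qed

section \<open>Accretivity across the hyperplane\<close>

definition ramp :: "nat \<Rightarrow> real \<Rightarrow> real" where
  "ramp n r = min 1 (real n * max 0 r)"

lemma cutoff_ramp: "cutoff (ramp n)"
  unfolding cutoff_def ramp_def
  by (auto intro!: monoI min.mono mult_left_mono max.mono simp: max_def)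

lemma ramp_lipschitz: "\<bar>ramp n r - ramp n t\<bar> \<le> real n * \<bar>r - t\<bar>"
proof -
  have "\<bar>ramp n r - ramp n t\<bar> \<le> \<bar>real n * max 0 r - real n * max 0 t\<bar>"
    by (auto simp: ramp_def min_def)
  also have "\<dots> = real n * \<bar>max 0 r - max 0 t\<bar>"
    by (simp add: abs_mult flip: right_diff_distrib)
  also have "\<dots> \<le> real n * \<bar>r - t\<bar>" by (intro mult_left_mono) auto
  finally show ?thesis .
qed

lemma ramp_bound: "\<bar>ramp n r\<bar> \<le> 1"
  by (auto simp: ramp_def)

lemma ramp_tendsto: "(\<lambda>n. ramp n r) \<longlonglongrightarrow> (if 0 < r then 1 else 0)"
proof (cases "0 < r")
  case True
  have "\<forall>\<^sub>F n in sequentially. 1 / r \<le> real n"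
    using filterlim_real_sequentially by (simp add: filterlim_at_top)
  then have "\<forall>\<^sub>F n in sequentially. ramp n r = 1"
    by eventually_elim (use True in \<open>simp add: ramp_def field_simps\<close>)
  then show ?thesis using True by (simp add: tendsto_eventually)
qed (simp add: ramp_def)

lemma integral_frac_p_Laplacian_test_nonneg:
  fixes a :: "real ^ 'd"
  assumes a: "a \<noteq> 0" and p: "1 < p" and s: "0 < s" and w: "frac_p_Laplacian s p w v"
  shows "0 \<le> (\<integral>x. v x * reflection_test a b (ramp n) w x \<partial>lborel)"
proof -
  let ?\<xi> = "reflection_test a b (ramp n) w"
  let ?\<kappa> = "real CARD('d) + s * p"
  have "?\<xi> \<in> Wsp s p \<inter> Lq 2"
    using w p s reflection_test_in_Wsp[OF a cutoff_ramp ramp_lipschitz, of p s w b n]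
      reflection_test_in_Lq[OF a cutoff_ramp ramp_lipschitz, of 2 w b n]
    by (simp add: frac_p_Laplacian_def)
  then have "(\<integral>x. v x * ?\<xi> x \<partial>lborel)
      = 1 / 2 * (\<integral>z. energy_density (\<lambda>r. spow r (p - 1)) ?\<kappa> w ?\<xi> z \<partial>(lborel \<Otimes>\<^sub>M lborel))"
    using w unfolding frac_p_Laplacian_def energy_density_def by blast
  moreover have "mono (\<lambda>r. spow r (p - 1))"
    using p by (intro strict_mono_mono strict_mono_spow) simp
  then have "0 \<le> (\<integral>z. energy_density (\<lambda>r. spow r (p - 1)) ?\<kappa> w ?\<xi> z \<partial>(lborel \<Otimes>\<^sub>M lborel))"
    using p s by (intro integral_energy_density_nonneg[OF a _ cutoff_ramp]) auto
  ultimately show ?thesis by simp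
qed

text \<open>
  Invariant under the reflection: on both sides it is the value of \<open>f\<close> on the positive side minus
  the value at the mirror point on the negative side.
\<close>

definition side_jump :: "real ^ 'd \<Rightarrow> real \<Rightarrow> (real ^ 'd \<Rightarrow> real) \<Rightarrow> real ^ 'd \<Rightarrow> real" where
  "side_jump a b f x = sgn (a \<bullet> x - b) * (f x - f (hyperplane_reflection a b x))"

lemma side_jump_borel [measurable]:
  assumes [measurable]: "f \<in> borel_measurable borel"
  shows "side_jump a b f \<in> borel_measurable borel"
  unfolding side_jump_def[abs_def] by measurable

lemma integrable_side_jump:
  assumes a: "a \<noteq> 0" and f: "integrable lborel f"
  shows "integrable lborel (side_jump a b f)"
proof -
  note i = Bochner_Integration.integrable_diff[OF f integrable_hyperplane_reflection[OF a f, of b]]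
  have [measurable]: "f \<in> borel_measurable borel" using f by simp
  show ?thesis
    by (rule Bochner_Integration.integrable_bound[OF i])
      (auto intro!: AE_I2 simp: side_jump_def abs_mult abs_sgn_eq)
qed

text \<open>
  The limit \<open>n \<rightarrow> \<infinity>\<close> of the tested equation. Since the test function is odd under the
  reflection, twice the integral of \<open>v \<xi>\<close> is the integral of the jump of \<open>v\<close> times the ramp of the
  jump of \<open>w\<close>, and the absolute jump of \<open>v\<close> dominates this integrand for every \<open>n\<close>.
\<close>

lemma integral_side_jump_accretive:
  fixes a :: "real ^ 'd"
  assumes a: "a \<noteq> 0" and p: "1 < p" and s: "0 < s"
    and w: "frac_p_Laplacian s p w v" and v: "integrable lborel v"
  shows "0 \<le> (\<integral>x. side_jump a b v x * (if 0 < side_jump a b w x then 1 else 0) \<partial>lborel)"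
proof -
  define R where "R = hyperplane_reflection a b"
  have [measurable]: "w \<in> borel_measurable borel" "v \<in> borel_measurable borel"
    using w by (simp_all add: frac_p_Laplacian_def Wsp_def Lq_def)
  have [measurable]: "ramp n \<in> borel_measurable borel" for n
    unfolding ramp_def[abs_def] by measurable
  let ?J = "side_jump a b"
  have \<xi>: "reflection_test a b (ramp n) w x = sgn (a \<bullet> x - b) * ramp n (?J w x)" for n x
    by (simp add: reflection_test_def side_jump_def)
  have nonneg: "0 \<le> (\<integral>x. ?J v x * ramp n (?J w x) \<partial>lborel)" for n
  proof -
    let ?\<xi> = "reflection_test a b (ramp n) w"
    have [measurable]: "?\<xi> \<in> borel_measurable borel"
      by (rule reflection_test_borel[OF cutoff_ramp]) simp
    have "\<bar>?\<xi> x\<bar> \<le> 1" for x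
      using ramp_bound[of n "?J w x"] by (simp add: \<xi> abs_mult abs_sgn_eq)
    then have "\<bar>v x * ?\<xi> x\<bar> \<le> \<bar>v x\<bar>" for x
      by (simp add: abs_mult mult_left_le)
    then have i: "integrable lborel (\<lambda>x. v x * ?\<xi> x)"
      by (intro Bochner_Integration.integrable_bound[OF v]) auto
    have "?J v x * ramp n (?J w x) = v x * ?\<xi> x + v (R x) * ?\<xi> (R x)" for x
      using reflection_test_odd[OF a, of b "ramp n" w x]
      by (simp add: R_def \<xi> side_jump_def algebra_simps)
    then have "(\<integral>x. ?J v x * ramp n (?J w x) \<partial>lborel)
        = (\<integral>x. v x * ?\<xi> x \<partial>lborel) + (\<integral>x. v (R x) * ?\<xi> (R x) \<partial>lborel)"
      using i integrable_hyperplane_reflection[OF a i, of b] by (simp add: R_def)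
    also have "\<dots> = 2 * (\<integral>x. v x * ?\<xi> x \<partial>lborel)"
      using integral_hyperplane_reflection[OF a, of "\<lambda>x. v x * ?\<xi> x" b] by (simp add: R_def)
    also have "\<dots> \<ge> 0" using integral_frac_p_Laplacian_test_nonneg[OF a p s w] by simp
    finally show ?thesis .
  qed
  have "(\<lambda>n. \<integral>x. ?J v x * ramp n (?J w x) \<partial>lborel)
      \<longlonglongrightarrow> (\<integral>x. ?J v x * (if 0 < ?J w x then 1 else 0) \<partial>lborel)"
  proof (rule integral_dominated_convergence)
    show "integrable lborel (\<lambda>x. \<bar>?J v x\<bar>)" using integrable_side_jump[OF a v] by simp
    show "AE x in lborel. (\<lambda>n. ?J v x * ramp n (?J w x))
        \<longlonglongrightarrow> ?J v x * (if 0 < ?J w x then 1 else 0)"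
      by (intro AE_I2 tendsto_mult_left ramp_tendsto)
    show "AE x in lborel. norm (?J v x * ramp n (?J w x)) \<le> \<bar>?J v x\<bar>" for n
      using ramp_bound by (auto intro!: AE_I2 simp: abs_mult mult_left_le)
  qed measurable
  then show ?thesis by (rule LIMSEQ_le_const) (use nonneg in auto)
qed

section \<open>The reflection defect along the Euler scheme\<close>

definition reflection_defect :: "real ^ 'd \<Rightarrow> real \<Rightarrow> (real ^ 'd \<Rightarrow> real) \<Rightarrow> real" where
  "reflection_defect a b f = (\<integral>x. max 0 (side_jump a b f x) \<partial>lborel)"

lemma integrable_defect_density:
  assumes "a \<noteq> 0" and "integrable lborel f"
  shows "integrable lborel (\<lambda>x. max 0 (side_jump a b f x))"
  using integrable_side_jump[OF assms, of b] by (intro integrable_max) auto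

lemma reflection_defect_nonneg: "0 \<le> reflection_defect a b f"
  unfolding reflection_defect_def by (rule integral_nonneg_AE) simp

text \<open>
  On the set where \<open>u\<close> has a positive jump, adding \<open>h\<close> times the jump of \<open>v\<close> does not decrease the
  integral, by accretivity; this set is also the one where the power of \<open>u\<close> has a positive jump,
  because \<open>r \<mapsto> \<bar>r\<bar>\<^bsup>m-1\<^esup> r\<close> is strictly increasing. The sum of the two jumps is at most the positive
  part of the jump of \<open>u + h v\<close>.
\<close>

lemma reflection_defect_resolvent_le:
  fixes a :: "real ^ 'd"
  assumes a: "a \<noteq> 0" and p: "1 < p" and s: "0 < s" and m: "0 < m" and h: "0 \<le> h"
    and u: "integrable lborel u" and v: "integrable lborel v"
    and uv: "frac_p_Laplacian s p (\<lambda>x. spow (u x) m) v"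
  shows "reflection_defect a b u \<le> reflection_defect a b (\<lambda>x. u x + h * v x)"
proof -
  let ?J = "side_jump a b"
  let ?w = "\<lambda>x. spow (u x) m"
  let ?f = "\<lambda>x. u x + h * v x"
  define \<theta> :: "real ^ 'd \<Rightarrow> real" where "\<theta> x = (if 0 < ?J u x then 1 else 0)" for x
  have [measurable]: "u \<in> borel_measurable borel" "v \<in> borel_measurable borel" using u v by auto
  have [measurable]: "\<theta> \<in> borel_measurable borel" unfolding \<theta>_def[abs_def] by measurable
  have iff: "spow r m < spow t m \<longleftrightarrow> r < t" for r t
    using strict_mono_less[OF strict_mono_spow[OF m]] by simp
  have "0 < ?J ?w x \<longleftrightarrow> 0 < ?J u x" for x
    by (auto simp: side_jump_def zero_less_mult_iff iff)
  then have acc: "0 \<le> (\<integral>x. ?J v x * \<theta> x \<partial>lborel)"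
    using integral_side_jump_accretive[OF a p s uv v, of b] by (simp add: \<theta>_def)
  have iv: "integrable lborel (\<lambda>x. ?J v x * \<theta> x)"
    by (rule Bochner_Integration.integrable_bound[OF integrable_side_jump[OF a v, of b]])
      (auto simp: \<theta>_def)
  have f: "integrable lborel ?f" using u v by simp
  have "reflection_defect a b u
      \<le> (\<integral>x. max 0 (?J u x) \<partial>lborel) + h * (\<integral>x. ?J v x * \<theta> x \<partial>lborel)"
    using acc h by (simp add: reflection_defect_def)
  also have "\<dots> = (\<integral>x. max 0 (?J u x) + h * (?J v x * \<theta> x) \<partial>lborel)"
    using iv integrable_defect_density[OF a u, of b] by simp
  also have "\<dots> \<le> (\<integral>x. max 0 (?J ?f x) \<partial>lborel)"
  proof (rule integral_mono)
    have "?J ?f x = ?J u x + h * ?J v x" for x by (simp add: side_jump_def algebra_simps)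
    then show "max 0 (?J u x) + h * (?J v x * \<theta> x) \<le> max 0 (?J ?f x)" for x
      by (simp add: \<theta>_def)
  qed (use iv integrable_defect_density[OF a u, of b] integrable_defect_density[OF a f, of b] in auto)
  finally show ?thesis by (simp add: reflection_defect_def)
qed

lemma reflection_defect_lipschitz:
  fixes a :: "real ^ 'd"
  assumes a: "a \<noteq> 0" and f: "integrable lborel f" and g: "integrable lborel g"
  shows "reflection_defect a b f \<le> reflection_defect a b g + 2 * L1_dist f g"
proof -
  define R where "R = hyperplane_reflection a b"
  let ?J = "side_jump a b" and ?d = "\<lambda>x. \<bar>f x - g x\<bar>"
  have d: "integrable lborel ?d" using f g by simp
  have dR: "integrable lborel (\<lambda>x. ?d (R x))"
    using integrable_hyperplane_reflection[OF a d, of b] by (simp add: R_def)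
  have ig: "integrable lborel (\<lambda>x. max 0 (?J g x))" by (rule integrable_defect_density[OF a g])
  have [measurable]: "f \<in> borel_measurable borel" "g \<in> borel_measurable borel" using f g by auto
  have "reflection_defect a b f \<le> (\<integral>x. max 0 (?J g x) + (?d x + ?d (R x)) \<partial>lborel)"
    unfolding reflection_defect_def
  proof (rule integral_mono)
    fix x
    have "?J f x - ?J g x = sgn (a \<bullet> x - b) * ((f x - g x) - (f (R x) - g (R x)))"
      by (simp add: side_jump_def R_def algebra_simps)
    also have "\<dots> \<le> \<bar>sgn (a \<bullet> x - b)\<bar> * \<bar>(f x - g x) - (f (R x) - g (R x))\<bar>"
      unfolding abs_mult[symmetric] by (rule abs_ge_self)
    also have "\<dots> \<le> ?d x + ?d (R x)" by (simp add: abs_sgn_eq abs_triangle_ineq4)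
    finally show "max 0 (?J f x) \<le> max 0 (?J g x) + (?d x + ?d (R x))" by linarith
  qed (use d dR ig integrable_defect_density[OF a f, of b] in \<open>auto intro!: Bochner_Integration.integrable_add\<close>)
  also have "\<dots> = (\<integral>x. max 0 (?J g x) \<partial>lborel)
      + ((\<integral>x. ?d x \<partial>lborel) + (\<integral>x. ?d (R x) \<partial>lborel))"
    by (simp only: Bochner_Integration.integral_add[OF ig Bochner_Integration.integrable_add[OF d dR]]
        Bochner_Integration.integral_add[OF d dR])
  also have "(\<integral>x. ?d (R x) \<partial>lborel) = (\<integral>x. ?d x \<partial>lborel)"
    unfolding R_def by (rule integral_hyperplane_reflection[OF a]) measurable
  finally show ?thesis by (simp add: reflection_defect_def L1_dist_def)
qed

lemma L1_dist_commute: "L1_dist f g = L1_dist g f"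
  by (simp add: L1_dist_def abs_minus_commute)

lemma L1_dist_AE_eq: "AE x in lborel. f x = g x \<Longrightarrow> L1_dist f g = 0"
  unfolding L1_dist_def by (rule integral_eq_zero_AE) (auto elim: eventually_mono)

text \<open>
  Passage to the closure. The right-hand sides \<open>uk + h vk\<close> of the approximations need not be
  ordered across the hyperplane even if \<open>u + h v\<close> is; this is why the resolvent estimate is an
  inequality between defects.
\<close>

lemma reflection_defect_operator_A_le:
  fixes a :: "real ^ 'd"
  assumes a: "a \<noteq> 0" and p: "1 < p" and s: "0 < s" and m: "0 < m" and h: "0 \<le> h"
    and uv: "(u, v) \<in> operator_A s p m"
  shows "reflection_defect a b u \<le> reflection_defect a b (\<lambda>x. u x + h * v x)"
proof -
  let ?D = "reflection_defect a b"
  from uv obtain uk vk where u: "integrable lborel u" and v: "integrable lborel v"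
    and k: "\<And>k::nat. integrable lborel (uk k)" "\<And>k. integrable lborel (vk k)"
      "\<And>k. frac_p_Laplacian s p (\<lambda>x. spow (uk k x) m) (vk k)"
    and lim: "(\<lambda>k. L1_dist (uk k) u) \<longlonglongrightarrow> 0" "(\<lambda>k. L1_dist (vk k) v) \<longlonglongrightarrow> 0"
    unfolding operator_A_def frac_p_Laplacian_1inf_def L1_def by blast
  let ?f = "\<lambda>x. u x + h * v x" and ?fk = "\<lambda>k x. uk k x + h * vk k x"
  have bound: "?D u \<le> ?D ?f + 4 * L1_dist (uk k) u + 2 * h * L1_dist (vk k) v" for k
  proof -
    have "?D u \<le> ?D (uk k) + 2 * L1_dist (uk k) u"
      using reflection_defect_lipschitz[OF a u k(1)] by (simp add: L1_dist_commute)
    moreover have "?D (uk k) \<le> ?D (?fk k)"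
      using reflection_defect_resolvent_le[OF a p s m h k] .
    moreover have "?D (?fk k) \<le> ?D ?f + 2 * L1_dist (?fk k) ?f"
      using u v k by (intro reflection_defect_lipschitz[OF a]) auto
    moreover have "L1_dist (?fk k) ?f \<le> L1_dist (uk k) u + h * L1_dist (vk k) v"
    proof -
      have "L1_dist (?fk k) ?f \<le> (\<integral>x. \<bar>uk k x - u x\<bar> + h * \<bar>vk k x - v x\<bar> \<partial>lborel)"
        unfolding L1_dist_def
      proof (rule integral_mono)
        fix x
        have "\<bar>?fk k x - ?f x\<bar> = \<bar>(uk k x - u x) + h * (vk k x - v x)\<bar>" by (simp add: algebra_simps)
        also have "\<dots> \<le> \<bar>uk k x - u x\<bar> + \<bar>h * (vk k x - v x)\<bar>" by (rule abs_triangle_ineq)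
        finally show "\<bar>?fk k x - ?f x\<bar> \<le> \<bar>uk k x - u x\<bar> + h * \<bar>vk k x - v x\<bar>"
          using h by (simp add: abs_mult)
      qed (use u v k in auto)
      also have "\<dots> = L1_dist (uk k) u + h * L1_dist (vk k) v"
        using u v k by (simp add: L1_dist_def)
      finally show ?thesis .
    qed
    ultimately show ?thesis by linarith
  qed
  have "(\<lambda>k. ?D ?f + 4 * L1_dist (uk k) u + 2 * h * L1_dist (vk k) v) \<longlonglongrightarrow> ?D ?f + 4 * 0 + 2 * h * 0"
    by (intro tendsto_intros lim)
  then show ?thesis using bound by (intro LIMSEQ_le_const) auto
qed

lemma reflection_defect_euler_scheme:
  fixes a :: "real ^ 'd"
  assumes a: "a \<noteq> 0" and p: "1 < p" and s: "0 < s" and m: "0 < m"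
    and u0: "u0 \<in> L1" and E: "euler_scheme (operator_A s p m) u0 T \<epsilon> N \<tau> U" and i: "i \<le> N"
  shows "U i \<in> L1 \<and> reflection_defect a b (U i) \<le> reflection_defect a b u0"
  using i
proof (induction i)
  case 0
  have "U 0 \<in> L1" "L1_dist (U 0) u0 = 0"
    using E by (auto simp: euler_scheme_def intro: L1_dist_AE_eq)
  then show ?case
    using reflection_defect_lipschitz[OF a, of "U 0" u0 b] u0 by (simp add: L1_def)
next
  case (Suc i)
  define h where "h = \<tau> (Suc i) - \<tau> i"
  from Suc.prems E obtain v where v: "(U (Suc i), v) \<in> operator_A s p m" and "0 \<le> h"
    and eq: "AE x in lborel. U (Suc i) x + h * v x = U i x"
    unfolding euler_scheme_def h_def by (fastforce simp: Suc_le_eq)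
  have int: "integrable lborel (U (Suc i))" "integrable lborel v" "integrable lborel (U i)"
    using v Suc by (auto simp: operator_A_def L1_def)
  have "reflection_defect a b (U (Suc i)) \<le> reflection_defect a b (\<lambda>x. U (Suc i) x + h * v x)"
    by (rule reflection_defect_operator_A_le[OF a p s m \<open>0 \<le> h\<close> v])
  also have "\<dots> \<le> reflection_defect a b (U i)"
    using reflection_defect_lipschitz[OF a, of "\<lambda>x. U (Suc i) x + h * v x" "U i" b] int L1_dist_AE_eq[OF eq]
    by simp
  finally show ?case using Suc int by (simp add: L1_def)
qed

text \<open>
  The index that the definite description picks is the predecessor of the first partition point
  beyond \<open>t\<close>.
\<close>

lemma step_function_eq:
  assumes "\<tau> 0 \<le> t" and "t < \<tau> N" and \<tau>: "\<And>i. i < N \<Longrightarrow> \<tau> i < \<tau> (Suc i)"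
  obtains i where "i < N" and "step_function N \<tau> U t = U i"
proof -
  have mono: "\<tau> i \<le> \<tau> j" if "i \<le> j" "j \<le> N" for i j
    using that by (induction j rule: dec_induct) (auto intro: order_trans[OF _ less_imp_le[OF \<tau>]])
  define j where "j = (LEAST j. t < \<tau> j)"
  have j: "t < \<tau> j" "j \<le> N"
    unfolding j_def by (rule LeastI[of _ N], rule assms, rule Least_le, rule assms)
  have before: "\<tau> i \<le> t" if "i < j" for i
    using not_less_Least[OF that[unfolded j_def]] by (simp add: not_less)
  from j obtain i where i: "j = Suc i" using assms(1) by (cases j) auto
  have "(THE i. i < N \<and> t \<in> {\<tau> i..<\<tau> (Suc i)}) = i"
  proof (rule the_equality)
    show "i < N \<and> t \<in> {\<tau> i..<\<tau> (Suc i)}" using i j before[of i] by auto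
  next
    fix k assume k: "k < N \<and> t \<in> {\<tau> k..<\<tau> (Suc k)}"
    show "k = i"
    proof (rule linorder_cases)
      assume "k < i"
      then have "\<tau> (Suc k) \<le> t" using before[of "Suc k"] i by simp
      then show ?thesis using k by simp
    next
      assume "i < k"
      then have "\<tau> (Suc i) \<le> \<tau> k" using k by (intro mono) auto
      then show ?thesis using k i j before[of i] by simp
    qed
  qed
  then show ?thesis using that[of i] i j before[of i] by (simp add: step_function_def)
qed

text \<open>
  The schemes are taken on \<open>[0, t + 1)\<close>, since the convergence on \<open>[0, t)\<close> would leave out \<open>t\<close>.
\<close>

lemma reflection_defect_mild_solution:
  fixes a :: "real ^ 'd"
  assumes a: "a \<noteq> 0" and p: "1 < p" and s: "0 < s" and m: "0 < m"
    and u: "mild_solution (operator_A s p m) u0 u" and t: "0 \<le> t"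
  shows "reflection_defect a b (u t) \<le> reflection_defect a b u0"
proof (rule field_le_epsilon)
  fix \<eta> :: real assume "0 < \<eta>"
  have u0: "u0 \<in> L1" and ut: "u t \<in> L1"
    using u t by (auto simp: mild_solution_def continuous_L1_def)
  have "0 < t + 1" using t by simp
  with u have "\<exists>N \<tau> U. (\<forall>\<epsilon>>0. euler_scheme (operator_A s p m) u0 (t + 1) \<epsilon> (N \<epsilon>) (\<tau> \<epsilon>) (U \<epsilon>)) \<and>
        (\<forall>\<eta>>0. \<forall>\<^sub>F \<epsilon> in at_right 0. \<forall>r\<in>{0..<t + 1}.
           L1_dist (step_function (N \<epsilon>) (\<tau> \<epsilon>) (U \<epsilon>) r) (u r) < \<eta>)"
    by (simp only: mild_solution_def)
  then obtain N \<tau> U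
    where E': "\<forall>\<epsilon>>0. euler_scheme (operator_A s p m) u0 (t + 1) \<epsilon> (N \<epsilon>) (\<tau> \<epsilon>) (U \<epsilon>)"
      and ev': "\<forall>\<eta>>0. \<forall>\<^sub>F \<epsilon> in at_right 0. \<forall>r\<in>{0..<t + 1}.
           L1_dist (step_function (N \<epsilon>) (\<tau> \<epsilon>) (U \<epsilon>) r) (u r) < \<eta>"
    by (elim exE conjE)
  note E = E'[rule_format]
  have ev: "\<forall>\<^sub>F \<epsilon> in at_right 0. \<forall>r\<in>{0..<t + 1}.
           L1_dist (step_function (N \<epsilon>) (\<tau> \<epsilon>) (U \<epsilon>) r) (u r) < \<eta> / 2"
    using \<open>0 < \<eta>\<close> by (intro ev'[rule_format]) simp
  have "\<forall>\<^sub>F \<epsilon> :: real in at_right 0. 0 < \<epsilon>" by (rule eventually_at_right_less)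
  from eventually_happens'[OF _ eventually_conj[OF this ev]]
  obtain \<epsilon> where \<epsilon>: "0 < \<epsilon>"
    and d: "L1_dist (step_function (N \<epsilon>) (\<tau> \<epsilon>) (U \<epsilon>) t) (u t) < \<eta> / 2"
    using t by force
  obtain i where i: "i < N \<epsilon>" and st: "step_function (N \<epsilon>) (\<tau> \<epsilon>) (U \<epsilon>) t = U \<epsilon> i"
  proof (rule step_function_eq)
    show "\<tau> \<epsilon> 0 \<le> t" "t < \<tau> \<epsilon> (N \<epsilon>)"
      using E[OF \<epsilon>] t by (simp_all add: euler_scheme_def)
    show "\<tau> \<epsilon> i < \<tau> \<epsilon> (Suc i)" if "i < N \<epsilon>" for i
      using E[OF \<epsilon>] t that by (simp_all add: euler_scheme_def)
  qed
  have U: "U \<epsilon> i \<in> L1" "reflection_defect a b (U \<epsilon> i) \<le> reflection_defect a b u0"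
    using reflection_defect_euler_scheme[OF a p s m u0 E[OF \<epsilon>]] i by auto
  have "reflection_defect a b (u t) \<le> reflection_defect a b (U \<epsilon> i) + 2 * L1_dist (u t) (U \<epsilon> i)"
    using ut U by (intro reflection_defect_lipschitz[OF a]) (auto simp: L1_def)
  also have "\<dots> \<le> reflection_defect a b u0 + \<eta>"
    using U d st by (simp add: L1_dist_commute)
  finally show "reflection_defect a b (u t) \<le> reflection_defect a b u0 + \<eta>" .
qed

lemma reflection_defect_le_0_iff:
  fixes a :: "real ^ 'd"
  assumes a: "a \<noteq> 0" and f: "f \<in> L1"
  shows "reflection_defect a b f \<le> 0 \<longleftrightarrow>
    (AE x in lborel. x \<in> half_space_pos a b \<longrightarrow> f x \<le> f (hyperplane_reflection a b x))"
proof -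
  let ?R = "hyperplane_reflection a b"
  have i: "integrable lborel (\<lambda>x. max 0 (side_jump a b f x))"
    using f by (intro integrable_defect_density[OF a]) (simp add: L1_def)
  have "reflection_defect a b f \<le> 0 \<longleftrightarrow> reflection_defect a b f = 0"
    using reflection_defect_nonneg[of a b f] by linarith
  also have "\<dots> \<longleftrightarrow> (AE x in lborel. max 0 (side_jump a b f x) = 0)"
    unfolding reflection_defect_def by (rule integral_nonneg_eq_0_iff_AE[OF i]) simp
  also have "\<dots> \<longleftrightarrow> (AE x in lborel. x \<in> half_space_pos a b \<longrightarrow> f x \<le> f (?R x))"
  proof
    assume "AE x in lborel. max 0 (side_jump a b f x) = 0"
    then show "AE x in lborel. x \<in> half_space_pos a b \<longrightarrow> f x \<le> f (?R x)"
      by eventually_elim (auto simp: side_jump_def half_space_pos_def max_def split: if_splits)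
  next
    \<comment> \<open>The hypothesis at the mirror point covers the negative side.\<close>
    assume *: "AE x in lborel. x \<in> half_space_pos a b \<longrightarrow> f x \<le> f (?R x)"
    from * AE_hyperplane_reflection[OF a *, of b]
    show "AE x in lborel. max 0 (side_jump a b f x) = 0"
    proof eventually_elim
      case (elim x)
      have "a \<bullet> ?R x - b = - (a \<bullet> x - b)" by (rule inner_hyperplane_reflection[OF a])
      then show ?case
        using elim by (cases "a \<bullet> x - b" "0 :: real" rule: linorder_cases)
          (auto simp: side_jump_def half_space_pos_def hyperplane_reflection_involution[OF a] max_def)
    qed
  qed
  finally show ?thesis .
qed

theorem theorem1p4:
  fixes p s m b :: real
    and a :: "real ^ 'd"
    and u0 :: "real ^ 'd \<Rightarrow> real"
    and u :: "real \<Rightarrow> real ^ 'd \<Rightarrow> real"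
  assumes "1 < p"
    and "0 < s" and "s < 1"
    and "m > s"
    and "a \<noteq> 0"
    and "u0 \<in> L1"
    and "mild_solution (operator_A s p m) u0 u"
    and "AE x in lborel. x \<in> half_space_pos a b \<longrightarrow> u0 x \<le> u0 (hyperplane_reflection a b x)"
  shows "\<forall>t>0. AE x in lborel. x \<in> half_space_pos a b \<longrightarrow>
           u t x \<le> u t (hyperplane_reflection a b x)"
proof (intro allI impI)
  fix t :: real assume t: "0 < t"
  have m: "0 < m" using assms by linarith
  have ut: "u t \<in> L1" using assms(7) t by (simp add: mild_solution_def continuous_L1_def)
  have "reflection_defect a b (u t) \<le> reflection_defect a b u0"
    using t by (intro reflection_defect_mild_solution[OF assms(5,1,2) m assms(7)]) simp
  also have "\<dots> \<le> 0" using assms(8) by (simp add: reflection_defect_le_0_iff[OF assms(5,6)])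
  finally show "AE x in lborel. x \<in> half_space_pos a b \<longrightarrow> u t x \<le> u t (hyperplane_reflection a b x)"
    by (simp add: reflection_defect_le_0_iff[OF assms(5) ut])
qed

end
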